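(* Let $H$ be a Hopf algebra over a field $k$ with bijective antipode $S$, and let $Y$ be an $H$-module/comodule. Then there is an isomorphism of cosimplicial $k$-modules $\Phi_*:\mathbb{T}_*(H,Y)\to B_*(\mathrm{coad}(H),H,Y)$, given for all $n\ge 0$ by $$\Phi_n(h^0\otimes h^1\otimes\cdots\otimes h^n\otimes y)=h^0_{(2)}\otimes\big((h^1\otimes\cdots\otimes h^n)\cdot S(h^0_{(1)})\big)\otimes y .$$
   Context: An $H$-module/comodule $Y$ is a left $H$-module that is also a left $H$-comodule (no compatibility assumed), with coaction $y\mapsto y_{(-1)}\otimes y_{(0)}\in H\otimes Y$; Sweedler notation is used throughout. "Cosimplicial" means pre-cosimplicial: only coface maps $\partial_0,\dots,\partial_{n+1}$ in each degree $n$, satisfying $\partial_i\partial_j=\partial_{j+1}\partial_i$ for $i\le j$; no codegeneracies are considered. $\mathbb{T}_n(H,Y)=H^{\otimes n+1}\otimes Y$ for $n\ge 0$. Put $\partial_0(h^0\otimes\cdots\otimes h^n\otimes y)=h^0_{(1)}\otimes h^0_{(2)}\otimes h^1\otimes\cdots\otimes h^n\otimes y$ and $\tau_n(h^0\otimes\cdots\otimes h^n\otimes y)=S^{-1}(y_{(-1)})h^n\otimes h^0\otimes\cdots\otimes h^{n-1}\otimes y_{(0)}$, which is invertible with $\tau_n^{-1}(h^0\otimes\cdots\otimes h^n\otimes y)=h^1\otimes\cdots\otimes h^n\otimes y_{(-1)}h^0\otimes y_{(0)}$. The coface maps are $\partial_j=\tau_{n+1}^j\partial_0\tau_n^{-j}$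 for $0\le j\le n+1$. Explicitly, for $0\le j\le n$, $\partial_j$ applies the comultiplication to $h^j$, and $\partial_{n+1}(h^0\otimes\cdots\otimes h^n\otimes y)=h^0_{(2)}\otimes h^1\otimes\cdots\otimes h^n\otimes y_{(-1)}h^0_{(1)}\otimes y_{(0)}$. For a coalgebra $C$, a right $C$-comodule $X$ (coaction $x\mapsto x_{(0)}\otimes x_{(1)}$) and a left $C$-comodule $Y$, the cobar complex is $B_n(X,C,Y)=X\otimes C^{\otimes n}\otimes Y$ with coface maps $d_0(x\otimes c^1\otimes\cdots\otimes c^n\otimes y)=x_{(0)}\otimes x_{(1)}\otimes c^1\otimes\cdots\otimes c^n\otimes y$; $d_j$ applies the comultiplication to $c^j$ for $0<j\le n$; $d_{n+1}(x\otimes c^1\otimes\cdots\otimes c^n\otimes y)=x\otimes c^1\otimes\cdots\otimes c^n\otimes y_{(-1)}\otimes y_{(0)}$. $\mathrm{coad}(H)$ is $H$ with the right $H$-comodule structure $h\mapsto h_{(2)}\otimes h_{(3)}S(h_{(1)})$. The right action of $H$ on $H^{\otimes n}$, $n\ge1$, is $(h^1\otimes\cdots\otimes h^n)\cdot h=h^1h_{(1)}\otimes\cdots\otimes h^nh_{(n)}$; for $n=0$ it is through the counit, so $\Phi_0=\mathrm{id}$. *)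

theory Defs
  imports Main "HOL.Vector_Spaces" "HOL-Library.Function_Algebras" "HOL-Library.FuncSet"
begin

section \<open>Tensor products\<close>

text \<open>
  A vector space over \<open>'k\<close> is a type with a scalar multiplication satisfying the library locale
  \<^locale>\<open>vector_space\<close>. An elementary tensor is indexed by a ``word'' of type \<open>'w\<close>, e.g. a pair
  \<open>(a, b)\<close> for \<open>A \<otimes> B\<close> or a list of length \<open>n\<close> for the \<open>n\<close>-th tensor power, and \<open>P\<close> is the
  predicate ``is a multilinear form on words''. The elementary tensor of \<open>w\<close> is the evaluation
  functional at \<open>w\<close> on multilinear forms (extended by 0 to all functions), and a tensor product is
  the linear span of elementary tensors. The universal property is proved below
  (\<open>tensors_universal\<close>, \<open>lin_ext_unique\<close> and the five \<open>_tensor\<close> lemmas).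
\<close>

type_synonym ('k, 'w) tensor = "('w \<Rightarrow> 'k) \<Rightarrow> 'k"

definition fscale :: "'k::field \<Rightarrow> ('k, 'w) tensor \<Rightarrow> ('k, 'w) tensor" where
  "fscale c t = (\<lambda>\<beta>. c * t \<beta>)"

definition ptens :: "(('w \<Rightarrow> 'k::field) \<Rightarrow> bool) \<Rightarrow> 'w \<Rightarrow> ('k, 'w) tensor" where
  "ptens P w = (\<lambda>\<beta>. if P \<beta> then \<beta> w else 0)"

definition tensors :: "(('w \<Rightarrow> 'k::field) \<Rightarrow> bool) \<Rightarrow> 'w set \<Rightarrow> ('k, 'w) tensor set" where
  "tensors P W = module.span fscale (ptens P ` W)"

text \<open>
  \<open>lin_ext P s f\<close> is the linear map, into a vector space with scalar multiplication \<open>s\<close>, which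
  sends the elementary tensor of \<open>w\<close> to \<open>f w\<close>. It is meaningful when \<open>f\<close> is multilinear, on words
  of every length where words contain lists.
\<close>

definition lin_ext ::
  "(('w \<Rightarrow> 'k::field) \<Rightarrow> bool) \<Rightarrow> ('k \<Rightarrow> 'z::ab_group_add \<Rightarrow> 'z) \<Rightarrow> ('w \<Rightarrow> 'z)
    \<Rightarrow> ('k, 'w) tensor \<Rightarrow> 'z" where
  "lin_ext P s f x =
     (THE z. \<exists>A c. finite A \<and> x = (\<Sum>w\<in>A. fscale (c w) (ptens P w)) \<and> z = (\<Sum>w\<in>A. s (c w) (f w)))"

definition linear_map_on ::
  "('k::field \<Rightarrow> 'v::ab_group_add \<Rightarrow> 'v) \<Rightarrow> 'v set \<Rightarrow> ('k \<Rightarrow> 'z::ab_group_add \<Rightarrow> 'z) \<Rightarrow> 'z set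
    \<Rightarrow> ('v \<Rightarrow> 'z) \<Rightarrow> bool" where
  "linear_map_on s V t Z f \<longleftrightarrow>
     f \<in> V \<rightarrow> Z \<and> (\<forall>x\<in>V. \<forall>y\<in>V. f (x + y) = f x + f y) \<and> (\<forall>c. \<forall>x\<in>V. f (s c x) = t c (f x))"

subsection \<open>Multilinear maps\<close>

definition bilin where
  "bilin sA sB t f \<longleftrightarrow>
     (\<forall>b. Vector_Spaces.linear sA t (\<lambda>a. f (a, b))) \<and>
     (\<forall>a. Vector_Spaces.linear sB t (\<lambda>b. f (a, b)))"

definition trilin where
  "trilin sA sB sC t f \<longleftrightarrow>
     (\<forall>b c. Vector_Spaces.linear sA t (\<lambda>a. f (a, b, c))) \<and>
     (\<forall>a c. Vector_Spaces.linear sB t (\<lambda>b. f (a, b, c))) \<and>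
     (\<forall>a b. Vector_Spaces.linear sC t (\<lambda>c. f (a, b, c)))"

text \<open>Lists of all lengths at once, independently of each other.\<close>

definition multilin where
  "multilin sH t f \<longleftrightarrow> (\<forall>us vs. Vector_Spaces.linear sH t (\<lambda>h. f (us @ h # vs)))"

text \<open>Words \<open>([h\<^sup>0, \<dots>, h\<^sup>n], y)\<close>.\<close>

definition multilinT where
  "multilinT sH sY t f \<longleftrightarrow>
     (\<forall>us vs y. Vector_Spaces.linear sH t (\<lambda>h. f (us @ h # vs, y))) \<and>
     (\<forall>hs. Vector_Spaces.linear sY t (\<lambda>y. f (hs, y)))"

text \<open>Words \<open>(x, [c\<^sup>1, \<dots>, c\<^sup>n], y)\<close>.\<close>

definition multilinB where
  "multilinB sX sC sY t f \<longleftrightarrow>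
     (\<forall>cs y. Vector_Spaces.linear sX t (\<lambda>x. f (x, cs, y))) \<and>
     (\<forall>x us vs y. Vector_Spaces.linear sC t (\<lambda>c. f (x, us @ c # vs, y))) \<and>
     (\<forall>x cs. Vector_Spaces.linear sY t (\<lambda>y. f (x, cs, y)))"

abbreviation tens2 where "tens2 sA sB a b \<equiv> ptens (bilin sA sB (*)) (a, b)"
abbreviation tens3 where "tens3 sA sB sC a b c \<equiv> ptens (trilin sA sB sC (*)) (a, b, c)"
abbreviation tensL where "tensL sH hs \<equiv> ptens (multilin sH (*)) hs"
abbreviation tensT where "tensT sH sY hs y \<equiv> ptens (multilinT sH sY (*)) (hs, y)"
abbreviation tensB where "tensB sX sC sY x cs y \<equiv> ptens (multilinB sX sC sY (*)) (x, cs, y)"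

text \<open>
  Sweedler notation: for \<open>u\<close> in \<open>A \<otimes> B\<close>, say a sum of \<open>u' \<otimes> u''\<close>, \<open>ext2 sA sB s f u\<close> is the sum
  of \<open>f u' u''\<close>; so \<open>ext2 sH sH s f (\<Delta> h)\<close> stands for \<open>f h\<^sub>(\<^sub>1\<^sub>) h\<^sub>(\<^sub>2\<^sub>)\<close>.
\<close>

abbreviation ext2 where "ext2 sA sB s f \<equiv> lin_ext (bilin sA sB (*)) s (\<lambda>(a, b). f a b)"
abbreviation extL where "extL sH s f \<equiv> lin_ext (multilin sH (*)) s f"
abbreviation extT where "extT sH sY s f \<equiv> lin_ext (multilinT sH sY (*)) s (\<lambda>(hs, y). f hs y)"
abbreviation extB where
  "extB sX sC sY s f \<equiv> lin_ext (multilinB sX sC sY (*)) s (\<lambda>(x, cs, y). f x cs y)"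

subsection \<open>Universal property\<close>

lemma vector_space_fscale: "vector_space fscale"
  by unfold_locales (auto simp: fscale_def fun_eq_iff algebra_simps)

lemma sum_tensor_apply: "(\<Sum>w\<in>A. g w) \<beta> = (\<Sum>w\<in>A. g w \<beta>)"
  for g :: "'a \<Rightarrow> 'b \<Rightarrow> 'c::comm_monoid_add"
  by (induction A rule: infinite_finite_induct) auto

lemma functionals_separate:
  assumes "vector_space s" and "\<And>\<phi>. Vector_Spaces.linear s (*) \<phi> \<Longrightarrow> \<phi> z = 0"
  shows "z = 0"
proof -
  interpret vector_space s by fact
  have ind: "independent (extend_basis {})" and sp: "span (extend_basis {}) = UNIV"
    using independent_extend_basis[OF independent_empty] span_extend_basis[OF independent_empty] .
  have "representation (extend_basis {}) z b = 0" for b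
    by (rule assms(2)[OF linear_representation[OF ind sp]])
  then show ?thesis
    using sum_nonzero_representation_eq[OF ind, of z] sp by simp
qed

lemma lin_ext_sum:
  fixes P :: "('w \<Rightarrow> 'k::field) \<Rightarrow> bool" and f :: "'w \<Rightarrow> 'z::ab_group_add"
  assumes s: "vector_space s" and f: "\<And>\<phi>. Vector_Spaces.linear s (*) \<phi> \<Longrightarrow> P (\<lambda>w. \<phi> (f w))"
    and A: "finite A"
  shows "lin_ext P s f (\<Sum>w\<in>A. fscale (c w) (ptens P w)) = (\<Sum>w\<in>A. s (c w) (f w))"
proof -
  interpret vector_space s by fact
  have key: "\<phi> (\<Sum>w\<in>B. s (d w) (f w)) = (\<Sum>w\<in>B. fscale (d w) (ptens P w)) (\<lambda>w. \<phi> (f w))"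
    if \<phi>: "Vector_Spaces.linear s (*) \<phi>" for \<phi> B d
  proof -
    interpret \<phi>: Vector_Spaces.linear s "(*)" \<phi> by fact
    show ?thesis
      by (simp add: \<phi>.sum \<phi>.scale sum_tensor_apply fscale_def ptens_def f[OF \<phi>])
  qed
  have eq: "z = z'"
    if "\<And>\<phi>. Vector_Spaces.linear s (*) \<phi> \<Longrightarrow> \<phi> z = \<phi> z'" for z z'
  proof -
    have "z - z' = 0"
    proof (rule functionals_separate[OF s])
      fix \<phi> assume \<phi>: "Vector_Spaces.linear s (*) \<phi>"
      interpret \<phi>: Vector_Spaces.linear s "(*)" \<phi> by fact
      show "\<phi> (z - z') = 0" using that[OF \<phi>] by (simp add: \<phi>.diff)
    qed
    then show ?thesis by simp
  qed
  show ?thesis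
    unfolding lin_ext_def
  proof (rule the_equality)
    show "\<exists>B d. finite B \<and> (\<Sum>w\<in>A. fscale (c w) (ptens P w)) = (\<Sum>w\<in>B. fscale (d w) (ptens P w)) \<and>
        (\<Sum>w\<in>A. s (c w) (f w)) = (\<Sum>w\<in>B. s (d w) (f w))"
      using A by blast
  next
    fix z assume "\<exists>B d. finite B \<and> (\<Sum>w\<in>A. fscale (c w) (ptens P w)) = (\<Sum>w\<in>B. fscale (d w) (ptens P w)) \<and>
        z = (\<Sum>w\<in>B. s (d w) (f w))"
    then show "z = (\<Sum>w\<in>A. s (c w) (f w))"
      by (auto intro!: eq simp: key)
  qed
qed

lemma tensors_eq:
  fixes P :: "('w \<Rightarrow> 'k::field) \<Rightarrow> bool"
  shows "tensors P W = {\<Sum>w\<in>A. fscale (c w) (ptens P w) | A c. finite A \<and> A \<subseteq> W}"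
proof -
  interpret vector_space "fscale :: 'k \<Rightarrow> ('k, 'w) tensor \<Rightarrow> _" by (rule vector_space_fscale)
  show ?thesis
  proof (intro equalityI subsetI)
    fix x assume "x \<in> tensors P W"
    then obtain T r where T: "finite T" "T \<subseteq> ptens P ` W" "x = (\<Sum>t\<in>T. fscale (r t) t)"
      unfolding tensors_def span_explicit by blast
    then obtain A where A: "A \<subseteq> W" "finite A" "inj_on (ptens P) A" "T = ptens P ` A"
      using T(1,2) subset_image_inj[of T "ptens P" W] by (auto dest: finite_imageD)
    then have "x = (\<Sum>w\<in>A. fscale (r (ptens P w)) (ptens P w))"
      using T by (simp add: sum.reindex)
    then show "x \<in> {\<Sum>w\<in>A. fscale (c w) (ptens P w) | A c. finite A \<and> A \<subseteq> W}"
      using A by (intro CollectI exI[of _ A] exI[of _ "\<lambda>w. r (ptens P w)"]) simp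
  next
    fix x assume "x \<in> {\<Sum>w\<in>A. fscale (c w) (ptens P w) | A c. finite A \<and> A \<subseteq> W}"
    then show "x \<in> tensors P W"
      unfolding tensors_def by (auto intro!: span_sum span_scale intro: span_base)
  qed
qed

lemma tensors_universal:
  fixes P :: "('w \<Rightarrow> 'k::field) \<Rightarrow> bool" and f :: "'w \<Rightarrow> 'z::ab_group_add"
  assumes s: "vector_space s" and f: "\<And>\<phi>. Vector_Spaces.linear s (*) \<phi> \<Longrightarrow> P (\<lambda>w. \<phi> (f w))"
  shows "lin_ext P s f (ptens P w) = f w"
    and "linear_map_on fscale (tensors P W) s UNIV (lin_ext P s f)"
proof -
  interpret vector_space s by fact
  interpret F: vector_space "fscale :: 'k \<Rightarrow> ('k, 'w) tensor \<Rightarrow> _" by (rule vector_space_fscale)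
  have sums: "lin_ext P s f (\<Sum>w\<in>A. fscale (c w) (ptens P w)) = (\<Sum>w\<in>A. s (c w) (f w))"
    if "finite A" for A c
    using s f that by (rule lin_ext_sum)
  show "lin_ext P s f (ptens P w) = f w"
    using sums[where A = "{w}" and c = "\<lambda>_. 1"] by simp
  have add: "lin_ext P s f (x + y) = lin_ext P s f x + lin_ext P s f y"
    if xy: "x \<in> tensors P W" "y \<in> tensors P W" for x y
  proof -
    obtain A c where x: "finite A" "x = (\<Sum>w\<in>A. fscale (c w) (ptens P w))"
      using xy(1) unfolding tensors_eq by blast
    obtain B d where y: "finite B" "y = (\<Sum>w\<in>B. fscale (d w) (ptens P w))"
      using xy(2) unfolding tensors_eq by blast
    define c' where "c' = (\<lambda>w. if w \<in> A then c w else 0)"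
    define d' where "d' = (\<lambda>w. if w \<in> B then d w else 0)"
    have x': "x = (\<Sum>w\<in>A\<union>B. fscale (c' w) (ptens P w))"
      unfolding x(2) by (rule sum.mono_neutral_cong_left) (use x y in \<open>auto simp: c'_def\<close>)
    have y': "y = (\<Sum>w\<in>A\<union>B. fscale (d' w) (ptens P w))"
      unfolding y(2) by (rule sum.mono_neutral_cong_left) (use x y in \<open>auto simp: d'_def\<close>)
    have fin: "finite (A \<union> B)" using x(1) y(1) by simp
    have "x + y = (\<Sum>w\<in>A\<union>B. fscale (c' w + d' w) (ptens P w))"
      unfolding x' y' by (simp only: F.scale_left_distrib sum.distrib)
    then have "lin_ext P s f (x + y) = (\<Sum>w\<in>A\<union>B. s (c' w + d' w) (f w))"
      by (simp only: sums[OF fin])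
    also have "\<dots> = (\<Sum>w\<in>A\<union>B. s (c' w) (f w)) + (\<Sum>w\<in>A\<union>B. s (d' w) (f w))"
      by (simp only: scale_left_distrib sum.distrib)
    also have "\<dots> = lin_ext P s f x + lin_ext P s f y"
      unfolding x' y' by (simp only: sums[OF fin])
    finally show ?thesis .
  qed
  have scl: "lin_ext P s f (fscale k x) = s k (lin_ext P s f x)" if xW: "x \<in> tensors P W" for k x
  proof -
    obtain A c where x: "finite A" "x = (\<Sum>w\<in>A. fscale (c w) (ptens P w))"
      using xW unfolding tensors_eq by blast
    have "fscale k x = (\<Sum>w\<in>A. fscale (k * c w) (ptens P w))"
      unfolding x(2) by (simp add: F.scale_sum_right)
    then have "lin_ext P s f (fscale k x) = (\<Sum>w\<in>A. s (k * c w) (f w))"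
      by (simp only: sums[OF x(1)])
    also have "\<dots> = s k (lin_ext P s f x)"
      unfolding x(2) sums[OF x(1)] by (simp add: scale_sum_right)
    finally show ?thesis .
  qed
  show "linear_map_on fscale (tensors P W) s UNIV (lin_ext P s f)"
    by (simp add: linear_map_on_def add scl)
qed

lemma lin_ext_unique:
  fixes P :: "('w \<Rightarrow> 'k::field) \<Rightarrow> bool" and f :: "'w \<Rightarrow> 'z::ab_group_add"
  assumes s: "vector_space s" and f: "\<And>\<phi>. Vector_Spaces.linear s (*) \<phi> \<Longrightarrow> P (\<lambda>w. \<phi> (f w))"
    and g: "linear_map_on fscale (tensors P W) s UNIV g" "\<And>w. w \<in> W \<Longrightarrow> g (ptens P w) = f w"
    and x: "x \<in> tensors P W"
  shows "g x = lin_ext P s f x"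
proof -
  interpret vector_space s by fact
  interpret F: vector_space "fscale :: 'k \<Rightarrow> ('k, 'w) tensor \<Rightarrow> _" by (rule vector_space_fscale)
  have "F.subspace {x \<in> tensors P W. g x = lin_ext P s f x}"
  proof (rule F.subspaceI)
    have "g 0 = 0" "lin_ext P s f 0 = 0"
      using g(1) tensors_universal(2)[where P = P and f = f and W = W, OF s f] F.span_zero[of "ptens P ` W"]
      unfolding linear_map_on_def tensors_def by (metis F.scale_zero_left scale_zero_left)+
    then show "0 \<in> {x \<in> tensors P W. g x = lin_ext P s f x}"
      by (simp add: tensors_def F.span_zero)
  qed (use g(1) tensors_universal(2)[where P = P and f = f and W = W, OF s f] in
      \<open>auto simp: linear_map_on_def tensors_def F.span_add F.span_scale\<close>)
  moreover have "ptens P ` W \<subseteq> {x \<in> tensors P W. g x = lin_ext P s f x}"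
    using g(2) tensors_universal(1)[where P = P and f = f, OF s f] by (auto simp: tensors_def F.span_base)
  ultimately show ?thesis
    using x F.span_minimal unfolding tensors_def by blast
qed

lemma linear_ptens:
  assumes "vector_space s" and "\<And>\<beta>. P \<beta> \<Longrightarrow> Vector_Spaces.linear s (*) (\<lambda>v. \<beta> (p v))"
  shows "Vector_Spaces.linear s fscale (\<lambda>v. ptens P (p v))"
  using assms vector_space_fscale
  by (auto simp: Vector_Spaces.linear_def module_hom_def module_hom_axioms_def
      module_iff_vector_space ptens_def fscale_def fun_eq_iff)

lemma linear_comp:
  assumes "Vector_Spaces.linear s t f" "Vector_Spaces.linear t u g"
  shows "Vector_Spaces.linear s u (\<lambda>x. g (f x))"
  using Vector_Spaces.linear_compose[OF assms] by (simp add: o_def)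

lemma bilin_tensor:
  assumes "vector_space sA" "vector_space sB"
  shows "bilin sA sB fscale (ptens (bilin sA sB (*)))"
    and "bilin sA sB t f \<Longrightarrow> Vector_Spaces.linear t u \<phi> \<Longrightarrow> bilin sA sB u (\<lambda>w. \<phi> (f w))"
  unfolding bilin_def using assms by (auto intro!: linear_ptens intro!: linear_comp[where g = \<phi> and t = t])

lemma trilin_tensor:
  assumes "vector_space sA" "vector_space sB" "vector_space sC"
  shows "trilin sA sB sC fscale (ptens (trilin sA sB sC (*)))"
    and "trilin sA sB sC t f \<Longrightarrow> Vector_Spaces.linear t u \<phi> \<Longrightarrow> trilin sA sB sC u (\<lambda>w. \<phi> (f w))"
  unfolding trilin_def using assms by (auto intro!: linear_ptens intro!: linear_comp[where g = \<phi> and t = t])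

lemma multilin_tensor:
  assumes "vector_space sH"
  shows "multilin sH fscale (ptens (multilin sH (*)))"
    and "multilin sH t f \<Longrightarrow> Vector_Spaces.linear t u \<phi> \<Longrightarrow> multilin sH u (\<lambda>w. \<phi> (f w))"
  unfolding multilin_def using assms by (auto intro!: linear_ptens intro!: linear_comp[where g = \<phi> and t = t])

lemma multilinT_tensor:
  assumes "vector_space sH" "vector_space sY"
  shows "multilinT sH sY fscale (ptens (multilinT sH sY (*)))"
    and "multilinT sH sY t f \<Longrightarrow> Vector_Spaces.linear t u \<phi> \<Longrightarrow> multilinT sH sY u (\<lambda>w. \<phi> (f w))"
  unfolding multilinT_def using assms by (auto intro!: linear_ptens intro!: linear_comp[where g = \<phi> and t = t])

lemma multilinB_tensor:
  assumes "vector_space sX" "vector_space sC" "vector_space sY"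
  shows "multilinB sX sC sY fscale (ptens (multilinB sX sC sY (*)))"
    and "multilinB sX sC sY t f \<Longrightarrow> Vector_Spaces.linear t u \<phi> \<Longrightarrow> multilinB sX sC sY u (\<lambda>w. \<phi> (f w))"
  unfolding multilinB_def using assms by (auto intro!: linear_ptens intro!: linear_comp[where g = \<phi> and t = t])

section \<open>Hopf algebras, modules and comodules\<close>

locale coalgebra = vector_space s
  for s :: "'k::field \<Rightarrow> 'c::ab_group_add \<Rightarrow> 'c" +
  fixes \<Delta> :: "'c \<Rightarrow> ('k, 'c \<times> 'c) tensor" and \<epsilon> :: "'c \<Rightarrow> 'k"
  assumes comult_closed: "\<Delta> c \<in> tensors (bilin s s (*)) UNIV"
    and comult_linear: "Vector_Spaces.linear s fscale \<Delta>"
    and counit_linear: "Vector_Spaces.linear s (*) \<epsilon>"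
    and coassoc:
      "ext2 s s fscale (\<lambda>a b. ext2 s s fscale (\<lambda>a1 a2. tens3 s s s a1 a2 b) (\<Delta> a)) (\<Delta> c) =
       ext2 s s fscale (\<lambda>a b. ext2 s s fscale (\<lambda>b1 b2. tens3 s s s a b1 b2) (\<Delta> b)) (\<Delta> c)"
    and counit_left: "ext2 s s s (\<lambda>a b. s (\<epsilon> a) b) (\<Delta> c) = c"
    and counit_right: "ext2 s s s (\<lambda>a b. s (\<epsilon> b) a) (\<Delta> c) = c"

locale unital_algebra = vector_space s
  for s :: "'k::field \<Rightarrow> 'h::ring_1 \<Rightarrow> 'h" +
  assumes scale_mult_left: "s c (x * y) = s c x * y"
    and scale_mult_right: "s c (x * y) = x * s c y"

locale hopf_algebra = unital_algebra s + coalgebra s \<Delta> \<epsilon>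
  for s :: "'k::field \<Rightarrow> 'h::ring_1 \<Rightarrow> 'h" and \<Delta> and \<epsilon> +
  fixes S :: "'h \<Rightarrow> 'h"
  assumes comult_mult:
      "\<Delta> (x * y) =
         ext2 s s fscale (\<lambda>a b. ext2 s s fscale (\<lambda>c d. tens2 s s (a * c) (b * d)) (\<Delta> y)) (\<Delta> x)"
    and comult_one: "\<Delta> 1 = tens2 s s 1 1"
    and counit_mult: "\<epsilon> (x * y) = \<epsilon> x * \<epsilon> y"
    and counit_one: "\<epsilon> 1 = 1"
    and antipode_linear: "Vector_Spaces.linear s s S"
    and antipode_left: "ext2 s s s (\<lambda>a b. S a * b) (\<Delta> x) = s (\<epsilon> x) 1"
    and antipode_right: "ext2 s s s (\<lambda>a b. a * S b) (\<Delta> x) = s (\<epsilon> x) 1"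

locale left_module =
  fixes sH :: "'k::field \<Rightarrow> 'h::ring_1 \<Rightarrow> 'h" and sY :: "'k \<Rightarrow> 'y::ab_group_add \<Rightarrow> 'y"
    and act :: "'h \<Rightarrow> 'y \<Rightarrow> 'y"
  assumes act_bilinear: "bilin sH sY sY (\<lambda>(h, y). act h y)"
    and act_mult: "act (g * h) y = act g (act h y)"
    and act_one: "act 1 y = y"

locale left_comodule = C: coalgebra sC \<Delta> \<epsilon> + Y: vector_space sY
  for sC :: "'k::field \<Rightarrow> 'c::ab_group_add \<Rightarrow> 'c" and \<Delta> and \<epsilon>
    and sY :: "'k \<Rightarrow> 'y::ab_group_add \<Rightarrow> 'y" +
  fixes \<rho> :: "'y \<Rightarrow> ('k, 'c \<times> 'y) tensor"
  assumes coact_closed: "\<rho> y \<in> tensors (bilin sC sY (*)) UNIV"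
    and coact_linear: "Vector_Spaces.linear sY fscale \<rho>"
    and coact_coassoc:
      "ext2 sC sY fscale (\<lambda>c y'. ext2 sC sC fscale (\<lambda>c1 c2. tens3 sC sC sY c1 c2 y') (\<Delta> c)) (\<rho> y) =
       ext2 sC sY fscale (\<lambda>c y'. ext2 sC sY fscale (\<lambda>c' y''. tens3 sC sC sY c c' y'') (\<rho> y')) (\<rho> y)"
    and coact_counit: "ext2 sC sY sY (\<lambda>c y'. sY (\<epsilon> c) y') (\<rho> y) = y"

text \<open>The coaction of \<open>coad(H)\<close>: \<open>h \<mapsto> h\<^sub>(\<^sub>2\<^sub>) \<otimes> h\<^sub>(\<^sub>3\<^sub>) S(h\<^sub>(\<^sub>1\<^sub>))\<close>.\<close>

definition coad where
  "coad sH \<Delta> S h =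
     ext2 sH sH fscale (\<lambda>h1 h'. ext2 sH sH fscale (\<lambda>h2 h3. tens2 sH sH h2 (h3 * S h1)) (\<Delta> h')) (\<Delta> h)"

text \<open>\<open>h \<mapsto> h\<^sub>(\<^sub>1\<^sub>) \<otimes> \<dots> \<otimes> h\<^sub>(\<^sub>n\<^sub>)\<close>, the counit for \<open>n = 0\<close>.\<close>

fun iter_comult ::
  "('k::field \<Rightarrow> 'h::ab_group_add \<Rightarrow> 'h) \<Rightarrow> ('h \<Rightarrow> ('k, 'h \<times> 'h) tensor) \<Rightarrow> ('h \<Rightarrow> 'k)
    \<Rightarrow> nat \<Rightarrow> 'h \<Rightarrow> ('k, 'h list) tensor" where
  "iter_comult sH \<Delta> \<epsilon> 0 h = fscale (\<epsilon> h) (tensL sH [])"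
| "iter_comult sH \<Delta> \<epsilon> (Suc 0) h = tensL sH [h]"
| "iter_comult sH \<Delta> \<epsilon> (Suc (Suc n)) h =
     ext2 sH sH fscale
       (\<lambda>a b. extL sH fscale (\<lambda>bs. tensL sH (a # bs)) (iter_comult sH \<Delta> \<epsilon> (Suc n) b)) (\<Delta> h)"

text \<open>
  The right action \<open>(h\<^sup>1 \<otimes> \<dots> \<otimes> h\<^sup>n) \<cdot> h\<close> on an elementary tensor, as an element of \<open>H\<^sup>\<otimes>\<^sup>n\<close>.
  The function being extended must be multilinear on lists of every length; since \<open>map2\<close> truncates,
  it is set to 0 on lists of length other than \<open>n\<close>.
\<close>

definition ract where
  "ract sH \<Delta> \<epsilon> hs h =
     extL sH fscale (\<lambda>gs. if length gs = length hs then tensL sH (map2 (*) hs gs) else 0)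
       (iter_comult sH \<Delta> \<epsilon> (length hs) h)"

section \<open>Cosimplicial modules without codegeneracies\<close>

definition cosimplicial_module ::
  "('k::field \<Rightarrow> 'v::ab_group_add \<Rightarrow> 'v) \<Rightarrow> (nat \<Rightarrow> 'v set) \<Rightarrow> (nat \<Rightarrow> nat \<Rightarrow> 'v \<Rightarrow> 'v) \<Rightarrow> bool" where
  "cosimplicial_module s V d \<longleftrightarrow>
     vector_space s \<and> (\<forall>n. module.subspace s (V n)) \<and>
     (\<forall>n. \<forall>i\<le>n + 1. linear_map_on s (V n) s (V (n + 1)) (d n i)) \<and>
     (\<forall>n. \<forall>j\<le>n + 1. \<forall>i\<le>j. \<forall>x\<in>V n. d (n + 1) i (d n j x) = d (n + 1) (j + 1) (d n i x))"

definition cosimplicial_iso where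
  "cosimplicial_iso s V d t W e \<Phi> \<longleftrightarrow>
     cosimplicial_module s V d \<and> cosimplicial_module t W e \<and>
     (\<forall>n. linear_map_on s (V n) t (W n) (\<Phi> n) \<and> bij_betw (\<Phi> n) (V n) (W n)) \<and>
     (\<forall>n. \<forall>i\<le>n + 1. \<forall>x\<in>V n. \<Phi> (n + 1) (d n i x) = e n i (\<Phi> n x))"

subsection \<open>The cosimplicial module \<open>T\<^sub>*(H, Y)\<close>\<close>

definition T_space where
  "T_space sH sY n = tensors (multilinT sH sY (*)) {(hs, y). length hs = n + 1}"

definition T_coface0 where
  "T_coface0 sH sY \<Delta> =
     extT sH sY fscale
       (\<lambda>hs y. ext2 sH sH fscale (\<lambda>a b. tensT sH sY (a # b # tl hs) y) (\<Delta> (hd hs)))"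

text \<open>One map for all \<open>n\<close>; \<open>\<tau>\<^sub>n\<close> is its restriction to \<open>T\<^sub>n\<close>.\<close>

definition T_tau where
  "T_tau sH sY S \<rho> =
     extT sH sY fscale
       (\<lambda>hs y. ext2 sH sY fscale (\<lambda>a y'. tensT sH sY ((inv S a * last hs) # butlast hs) y') (\<rho> y))"

definition T_coface where
  "T_coface sH sY \<Delta> S \<rho> n j =
     (T_tau sH sY S \<rho> ^^ j) \<circ> T_coface0 sH sY \<Delta> \<circ>
     (inv_into (T_space sH sY n) (T_tau sH sY S \<rho>) ^^ j)"

subsection \<open>The cobar complex \<open>B\<^sub>*(X, C, Y)\<close>\<close>

definition B_space where
  "B_space sX sC sY n = tensors (multilinB sX sC sY (*)) {(x, cs, y). length cs = n}"

text \<open>The list \<open>[c\<^sup>1, \<dots>, c\<^sup>n]\<close> is indexed from 0, so \<open>c\<^sup>j\<close> is \<open>cs ! (j - 1)\<close>.\<close>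

definition B_coface where
  "B_coface sX sC sY \<Delta> \<rho>X \<rho>Y n j =
     extB sX sC sY fscale
       (\<lambda>x cs y.
          if j = 0 then
            ext2 sX sC fscale (\<lambda>x' c. tensB sX sC sY x' (c # cs) y) (\<rho>X x)
          else if j \<le> n then
            ext2 sC sC fscale
              (\<lambda>a b. tensB sX sC sY x (take (j - 1) cs @ a # b # drop j cs) y) (\<Delta> (cs ! (j - 1)))
          else
            ext2 sC sY fscale (\<lambda>c y'. tensB sX sC sY x (cs @ [c]) y') (\<rho>Y y))"

end

theory Submission
  imports Defs
begin

text \<open>
  In Sweedler notation the theorem is a handful of short computations. The candidate inverse of
  \<open>\<Phi>\<close> is
  \<open>\<Psi> (x \<otimes> (c\<^sup>1 \<otimes> \<dots> \<otimes> c\<^sup>n) \<otimes> y) = x\<^sub>(\<^sub>2\<^sub>) \<otimes> ((c\<^sup>1 \<otimes> \<dots> \<otimes> c\<^sup>n) \<cdot> x\<^sub>(\<^sub>1\<^sub>)) \<otimes> y\<close>: since the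
  diagonal action is an action (\<open>diag_mult\<close>, \<open>diag_one\<close>), both composites collapse by the antipode
  axioms (\<open>PsiF_PhiF\<close>, \<open>PhiF_PsiF\<close>). That \<open>\<Phi>\<close> commutes with the cofaces (\<open>TdF_PhiF\<close>) rests on
  two facts. For the inner cofaces, acting diagonally commutes with comultiplying one tensor factor,
  because \<open>\<Delta>\<close> is multiplicative (\<open>diag_comult_at\<close>). For the two outer cofaces, the antipode
  reverses the comultiplication (\<open>sw_S\<close>), which turns \<open>\<Delta> (S h)\<close> into \<open>S h\<^sub>(\<^sub>2\<^sub>) \<otimes> S h\<^sub>(\<^sub>1\<^sub>)\<close>: at
  coface 0 this produces exactly the coaction of \<open>coad(H)\<close>, and at the last coface it places
  \<open>h\<^sub>(\<^sub>1\<^sub>) S(h\<^sub>(\<^sub>2\<^sub>)) = \<epsilon> h\<close> next to the coaction of \<open>Y\<close>.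

  Two further points need proof. The cofaces of \<open>T\<^sub>*(H, Y)\<close> are given as conjugates of \<open>\<partial>\<^sub>0\<close> by powers of
  \<open>\<tau>\<close>; the explicit formulas follow by induction from \<open>\<partial>\<^sub>j\<^sub>+\<^sub>1 \<tau> = \<tau> \<partial>\<^sub>j\<close> (\<open>TdF_tauF\<close>). This
  relation and the invertibility of \<open>\<tau>\<close> rest on the identities \<open>h\<^sub>(\<^sub>2\<^sub>) S\<^sup>-\<^sup>1(h\<^sub>(\<^sub>1\<^sub>)) = \<epsilon> h = S\<^sup>-\<^sup>1(h\<^sub>(\<^sub>2\<^sub>)) h\<^sub>(\<^sub>1\<^sub>)\<close>. The cosimplicial identities are checked on
  the explicit cofaces of \<open>T\<^sub>*(H, Y)\<close> (\<open>TdF_cosimplicial\<close>) and carried to the cobar complex along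
  the bijection \<open>\<Phi>\<close>, where they encode in particular the coassociativity of \<open>coad(H)\<close>.

  The formal device behind the computations is duality. A tensor is a functional on multilinear
  forms, so a linear map \<open>G\<close> of tensor products is described by its transpose \<open>g\<close>, acting on forms
  by \<open>G t \<beta> = t (g \<beta>)\<close> (\<open>has_transpose\<close>). Two linear maps agree as soon as their transposes agree on
  the words spanning the source (\<open>has_transpose_eq\<close>), and an equation between transposes is an equation
  between scalars. In it, a Sweedler sum is a finite scalar sum (\<open>bsum\<close>), so that sums over
  independent tensors may be interchanged freely, and multilinearity is only needed where a Hopf
  algebra axiom is applied.
\<close>

section \<open>Tensors as functionals on multilinear forms\<close>

abbreviation lform :: "('k::field \<Rightarrow> 'v::ab_group_add \<Rightarrow> 'v) \<Rightarrow> ('v \<Rightarrow> 'k) \<Rightarrow> bool" where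
  "lform s f \<equiv> Vector_Spaces.linear s (*) f"

lemma vector_space_mult: "vector_space ((*) :: 'k::field \<Rightarrow> 'k \<Rightarrow> 'k)"
  by unfold_locales (auto simp: algebra_simps)

lemma linear_fscale_iff:
  "Vector_Spaces.linear s fscale p \<longleftrightarrow> vector_space s \<and> (\<forall>\<beta>. lform s (\<lambda>v. p v \<beta>))"
  by (auto simp: Vector_Spaces.linear_iff vector_space_fscale vector_space_mult fscale_def fun_eq_iff)

lemma lform_eval: "lform fscale (\<lambda>t. t \<beta>)"
  by (auto simp: Vector_Spaces.linear_iff vector_space_fscale vector_space_mult fscale_def)

lemma lform_zero: "vector_space s \<Longrightarrow> lform s (\<lambda>v. 0)"
  by (auto simp: Vector_Spaces.linear_iff vector_space_mult)

lemma lform_space: "lform s f \<Longrightarrow> vector_space s"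
  by (auto simp: Vector_Spaces.linear_iff)

lemma lform_ite:
  assumes "vector_space s" "Q \<Longrightarrow> lform s f"
  shows "lform s (\<lambda>v. if Q then f v else 0)"
  by (cases Q) (auto intro: lform_zero assms)

lemma lform_mult_left: "lform s f \<Longrightarrow> lform s (\<lambda>v. c * f v)"
  by (auto simp: Vector_Spaces.linear_iff algebra_simps)

lemma lform_mult_right: "lform s f \<Longrightarrow> lform s (\<lambda>v. f v * c)"
  by (auto simp: Vector_Spaces.linear_iff algebra_simps)

lemma lform_sum:
  assumes "vector_space s" "\<And>i. i \<in> A \<Longrightarrow> lform s (\<lambda>v. f v i)"
  shows "lform s (\<lambda>v. \<Sum>i\<in>A. f v i)"
  using assms(2)
proof (induction A rule: infinite_finite_induct)
  case (insert x F)
  then have "lform s (\<lambda>v. f v x)" "lform s (\<lambda>v. \<Sum>i\<in>F. f v i)" by auto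
  with insert show ?case
    by (simp add: Vector_Spaces.linear_iff algebra_simps)
qed (simp_all add: lform_zero assms)

subsection \<open>Sums over a tensor\<close>

text \<open>
  A choice of finitely many elementary tensors adding up to \<open>t\<close>. Summing over a fixed expression of
  \<open>t\<close>, rather than evaluating \<open>t\<close>, makes sense for every function \<open>f\<close> of words: hence \<open>tsum\<close> is
  linear in \<open>f\<close> and satisfies Fubini's theorem without any multilinearity, and it agrees with
  \<open>t f\<close> when \<open>f\<close> is multilinear.
\<close>

definition trep :: "(('w \<Rightarrow> 'k::field) \<Rightarrow> bool) \<Rightarrow> ('k, 'w) tensor \<Rightarrow> 'w set \<times> ('w \<Rightarrow> 'k)" where
  "trep P t = (SOME Ac. finite (fst Ac) \<and> t = (\<Sum>w\<in>fst Ac. fscale (snd Ac w) (ptens P w)))"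

definition tsum :: "(('w \<Rightarrow> 'k::field) \<Rightarrow> bool) \<Rightarrow> ('k, 'w) tensor \<Rightarrow> ('w \<Rightarrow> 'k) \<Rightarrow> 'k" where
  "tsum P t f = (\<Sum>w\<in>fst (trep P t). snd (trep P t) w * f w)"

lemma trep_spec:
  assumes "t \<in> tensors P W"
  shows "finite (fst (trep P t))"
    and "t = (\<Sum>w\<in>fst (trep P t). fscale (snd (trep P t) w) (ptens P w))"
proof -
  obtain A c where "finite A" "t = (\<Sum>w\<in>A. fscale (c w) (ptens P w))"
    using assms unfolding tensors_eq by blast
  then have "\<exists>Ac. finite (fst Ac) \<and> t = (\<Sum>w\<in>fst Ac. fscale (snd Ac w) (ptens P w))"
    by (intro exI[of _ "(A, c)"]) simp
  from someI_ex[OF this]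
  show "finite (fst (trep P t))"
    and "t = (\<Sum>w\<in>fst (trep P t). fscale (snd (trep P t) w) (ptens P w))"
    unfolding trep_def by blast+
qed

lemma tsum_eval: "t \<in> tensors P W \<Longrightarrow> P \<beta> \<Longrightarrow> tsum P t \<beta> = t \<beta>"
  by (subst (2) trep_spec(2)[of t P W]) (simp_all add: sum_tensor_apply fscale_def ptens_def tsum_def)

text \<open>
  Elementary tensors vanish by definition on functions that are not multilinear, so a tensor is
  determined by its values on multilinear forms.
\<close>

lemma tensor_off: "t \<in> tensors P W \<Longrightarrow> \<not> P \<beta> \<Longrightarrow> t \<beta> = 0"
  by (subst trep_spec(2)[of t P W]) (simp_all add: sum_tensor_apply fscale_def ptens_def)

lemma tensor_agree:
  assumes t: "t \<in> tensors P W" and "P \<beta>" "P \<gamma>" and eq: "\<And>w. w \<in> W \<Longrightarrow> \<beta> w = \<gamma> w"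
  shows "t \<beta> = t \<gamma>"
proof -
  obtain A c where A: "A \<subseteq> W" "t = (\<Sum>w\<in>A. fscale (c w) (ptens P w))"
    using t unfolding tensors_eq by blast
  have "(\<Sum>w\<in>A. c w * \<beta> w) = (\<Sum>w\<in>A. c w * \<gamma> w)"
    by (rule sum.cong) (use A eq in auto)
  then show ?thesis
    unfolding A(2) using assms(2,3) by (simp add: sum_tensor_apply fscale_def ptens_def)
qed

lemma tensor_ext:
  assumes "t \<in> tensors P W" "u \<in> tensors P U" "\<And>\<beta>. P \<beta> \<Longrightarrow> t \<beta> = u \<beta>"
  shows "t = u"
proof
  fix \<beta> show "t \<beta> = u \<beta>"
    using assms by (cases "P \<beta>") (simp_all add: tensor_off)
qed

lemma tsum_swap:
  "tsum P t (\<lambda>w. tsum Q u (\<lambda>v. f w v)) = tsum Q u (\<lambda>v. tsum P t (\<lambda>w. f w v))"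
  unfolding tsum_def sum_distrib_left by (subst sum.swap) (simp add: ac_simps)

lemma tsum_mult_left: "tsum P t (\<lambda>w. c * f w) = c * tsum P t f"
  by (simp add: tsum_def sum_distrib_left ac_simps)

lemma tsum_zero: "tsum P t (\<lambda>w. 0) = 0"
  by (simp add: tsum_def)

lemma lform_tsum:
  assumes "\<And>w. lform s (\<lambda>v. f v w)"
  shows "lform s (\<lambda>v. tsum P t (\<lambda>w. f v w))"
  unfolding tsum_def
  by (rule lform_sum) (use lform_space[OF assms] in \<open>auto intro!: lform_mult_left assms\<close>)

lemma tsum_ptens:
  "tsum P t (\<lambda>w. ptens Q (g w) \<beta>) = (if Q \<beta> then tsum P t (\<lambda>w. \<beta> (g w)) else 0)"
  by (simp add: ptens_def tsum_zero)

text \<open>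
  The Sweedler sum in a vector space becomes, after applying a linear functional, a scalar sum over
  the same chosen expression of \<open>t\<close>; the value does not depend on that choice because
  linear extension does not.
\<close>

lemma lin_ext_tsum:
  fixes f :: "'w \<Rightarrow> 'z::ab_group_add"
  assumes t: "t \<in> tensors P W" and \<phi>: "lform s \<phi>"
    and f: "\<And>\<phi>. lform s \<phi> \<Longrightarrow> P (\<lambda>w. \<phi> (f w))"
  shows "\<phi> (lin_ext P s f t) = tsum P t (\<lambda>w. \<phi> (f w))"
proof -
  interpret Vector_Spaces.linear s "(*)" \<phi> by fact
  have "lin_ext P s f t = (\<Sum>w\<in>fst (trep P t). s (snd (trep P t) w) (f w))"
    by (subst trep_spec(2)[OF t], rule lin_ext_sum)
      (use lform_space[OF \<phi>] f trep_spec(1)[OF t] in auto)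
  then show ?thesis by (simp add: sum scale tsum_def)
qed

subsection \<open>Linear extension in the dual picture\<close>

text \<open>
  A tensor-valued map extends linearly if its composites with all linear functionals are multilinear,
  while a computation only controls the composites with evaluations at forms. For the kinds of
  multilinearity used here the evaluations suffice, since addition and scaling of tensors are
  pointwise. The second argument only fixes a type.
\<close>

definition pointwise_kind :: "(('w \<Rightarrow> 'k::field) \<Rightarrow> bool) \<Rightarrow> 'v itself \<Rightarrow> bool" where
  "pointwise_kind P _ \<longleftrightarrow> (\<forall>f :: 'w \<Rightarrow> ('k, 'v) tensor.
     (\<forall>\<beta>. P (\<lambda>w. f w \<beta>)) \<longrightarrow> (\<forall>\<phi>. lform fscale \<phi> \<longrightarrow> P (\<lambda>w. \<phi> (f w))))"

lemma pointwise_bilin: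
  fixes s1 :: "'k::field \<Rightarrow> _"
  assumes "vector_space s1" "vector_space sB"
  shows "pointwise_kind (bilin s1 sB (*)) TYPE('v)"
  unfolding pointwise_kind_def
  apply (intro allI impI)
  subgoal for f \<phi>
    by (rule bilin_tensor(2)[OF assms, where f = f and \<phi> = \<phi> and t = fscale])
      (use assms in \<open>auto simp: bilin_def linear_fscale_iff\<close>)
  done

lemma pointwise_multilin:
  fixes s1 :: "'k::field \<Rightarrow> _"
  assumes "vector_space s1"
  shows "pointwise_kind (multilin s1 (*)) TYPE('v)"
  unfolding pointwise_kind_def
  apply (intro allI impI)
  subgoal for f \<phi>
    by (rule multilin_tensor(2)[OF assms, where f = f and \<phi> = \<phi> and t = fscale])
      (use assms in \<open>auto simp: multilin_def linear_fscale_iff\<close>)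
  done

lemma pointwise_multilinT:
  fixes s1 :: "'k::field \<Rightarrow> _"
  assumes "vector_space s1" "vector_space sY"
  shows "pointwise_kind (multilinT s1 sY (*)) TYPE('v)"
  unfolding pointwise_kind_def
  apply (intro allI impI)
  subgoal for f \<phi>
    by (rule multilinT_tensor(2)[OF assms, where f = f and \<phi> = \<phi> and t = fscale])
      (use assms in \<open>auto simp: multilinT_def linear_fscale_iff\<close>)
  done

lemma pointwise_multilinB:
  fixes s1 :: "'k::field \<Rightarrow> _"
  assumes "vector_space s1" "vector_space sC" "vector_space sY"
  shows "pointwise_kind (multilinB s1 sC sY (*)) TYPE('v)"
  unfolding pointwise_kind_def
  apply (intro allI impI)
  subgoal for f \<phi>
    by (rule multilinB_tensor(2)[OF assms, where f = f and \<phi> = \<phi> and t = fscale])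
      (use assms in \<open>auto simp: multilinB_def linear_fscale_iff\<close>)
  done

lemma lin_ext_eval:
  fixes f :: "'w \<Rightarrow> ('k::field, 'v) tensor"
  assumes "pointwise_kind P TYPE('v)" "t \<in> tensors P W" "\<And>\<beta>. P (\<lambda>w. f w \<beta>)"
  shows "lin_ext P fscale f t \<beta> = tsum P t (\<lambda>w. f w \<beta>)"
  using assms by (intro lin_ext_tsum[OF assms(2) lform_eval]) (auto simp: pointwise_kind_def)

lemma lin_ext_in_subspace:
  fixes f :: "'w \<Rightarrow> ('k::field, 'v) tensor"
  assumes "pointwise_kind P TYPE('v)" "t \<in> tensors P W" "\<And>\<beta>. P (\<lambda>w. f w \<beta>)"
    and f: "\<And>w. w \<in> W \<Longrightarrow> f w \<in> tensors Q V"
  shows "lin_ext P fscale f t \<in> tensors Q V"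
proof -
  interpret vector_space "fscale :: 'k \<Rightarrow> ('k, 'v) tensor \<Rightarrow> _" by (rule vector_space_fscale)
  obtain A c where A: "finite A" "A \<subseteq> W" "t = (\<Sum>w\<in>A. fscale (c w) (ptens P w))"
    using assms(2) unfolding tensors_eq by blast
  have "lin_ext P fscale f t = (\<Sum>w\<in>A. fscale (c w) (f w))"
    unfolding A(3) by (rule lin_ext_sum)
      (use assms A(1) vector_space_fscale in \<open>auto simp: pointwise_kind_def\<close>)
  also have "\<dots> \<in> tensors Q V"
    unfolding tensors_def by (intro span_sum span_scale) (use f A in \<open>auto simp: tensors_def\<close>)
  finally show ?thesis .
qed

lemma ptens_in_tensors: "w \<in> W \<Longrightarrow> ptens P w \<in> tensors P W"
proof -
  interpret vector_space "fscale :: 'b \<Rightarrow> ('b, 'a) tensor \<Rightarrow> _" by (rule vector_space_fscale)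
  show "w \<in> W \<Longrightarrow> ptens P w \<in> tensors P W" unfolding tensors_def by (intro span_base) auto
qed

section \<open>Sweedler calculus\<close>

lemma bilinI:
  assumes "\<And>b. lform sA (\<lambda>a. F a b)" "\<And>a. lform sB (\<lambda>b. F a b)"
  shows "bilin sA sB (*) (\<lambda>(a, b). F a b)"
  using assms by (simp add: bilin_def)

lemma trilinI:
  assumes "\<And>b c. lform sA (\<lambda>a. F a b c)" "\<And>a c. lform sB (\<lambda>b. F a b c)" "\<And>a b. lform sC (\<lambda>c. F a b c)"
  shows "trilin sA sB sC (*) (\<lambda>(a, b, c). F a b c)"
  using assms by (simp add: trilin_def)

lemma trilinD:
  assumes "trilin sA sB sC (*) \<beta>"
  shows "lform sA (\<lambda>a. \<beta> (a, b, c))" "lform sB (\<lambda>b. \<beta> (a, b, c))" "lform sC (\<lambda>c. \<beta> (a, b, c))"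
  using assms by (auto simp: trilin_def)

lemma linear_self: "vector_space s \<Longrightarrow> Vector_Spaces.linear s s (\<lambda>x. x)"
  by (auto simp: Vector_Spaces.linear_iff)

lemma lform_ptens3:
  assumes "vector_space sA" "vector_space sB" "vector_space sC"
  shows "lform sA (\<lambda>a. tens3 sA sB sC a b c \<beta>)" "lform sB (\<lambda>b. tens3 sA sB sC a b c \<beta>)"
    "lform sC (\<lambda>c. tens3 sA sB sC a b c \<beta>)"
  using assms by (auto simp: ptens_def intro!: lform_ite dest: trilinD)

lemma lform_ptens2:
  assumes "vector_space sA" "vector_space sB"
  shows "lform sA (\<lambda>a. tens2 sA sB a b \<beta>)" "lform sB (\<lambda>b. tens2 sA sB a b \<beta>)"
  using assms by (auto simp: ptens_def bilin_def intro!: lform_ite)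

text \<open>
  The Sweedler sum of a scalar function: if \<open>t\<close> is a sum of \<open>t' \<otimes> t''\<close>, this is the sum of the values
  \<open>F t' t''\<close>.
\<close>

abbreviation bsum where "bsum sA sB t F \<equiv> tsum (bilin sA sB (*)) t (\<lambda>(a, b). F a b)"

lemma bsum_cong: "(\<And>a b. F a b = G a b) \<Longrightarrow> bsum sA sB t F = bsum sA sB t G"
  by simp

lemma bsum_swap:
  "bsum sA sB t (\<lambda>a b. bsum sC sD u (\<lambda>c d. F a b c d)) = bsum sC sD u (\<lambda>c d. bsum sA sB t (\<lambda>a b. F a b c d))"
  unfolding case_prod_unfold by (rule tsum_swap)

lemma bsum_mult_left: "bsum sA sB t (\<lambda>a b. c * F a b) = c * bsum sA sB t F"
  by (simp add: tsum_mult_left case_prod_unfold)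

lemma lform_bsum_arg:
  "(\<And>a b. lform s (\<lambda>x. F x a b)) \<Longrightarrow> lform s (\<lambda>x. bsum sA sB t (\<lambda>a b. F x a b))"
  by (rule lform_tsum) (simp add: case_prod_unfold)

lemma bsum_eval:
  assumes "t \<in> tensors (bilin sA sB (*)) W" "\<And>b. lform sA (\<lambda>a. F a b)" "\<And>a. lform sB (\<lambda>b. F a b)"
  shows "bsum sA sB t F = t (\<lambda>(a, b). F a b)"
  by (rule tsum_eval[OF assms(1)]) (simp add: bilin_def assms)

lemma lform_bsum:
  assumes t: "Vector_Spaces.linear s fscale t" "\<And>x. t x \<in> tensors (bilin sA sB (*)) UNIV"
    and F: "\<And>b. lform sA (\<lambda>a. F a b)" "\<And>a. lform sB (\<lambda>b. F a b)"
    and g: "Vector_Spaces.linear s' s g"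
  shows "lform s' (\<lambda>x. bsum sA sB (t (g x)) F)"
proof -
  have "lform s (\<lambda>x. t x (\<lambda>(a, b). F a b))"
    using linear_comp[OF t(1) lform_eval] by simp
  then have "lform s (\<lambda>x. bsum sA sB (t x) F)"
    by (simp add: bsum_eval[OF t(2)] F)
  from linear_comp[OF g this] show ?thesis .
qed

lemma apply_ext2:
  fixes f :: "'a::ab_group_add \<Rightarrow> 'b::ab_group_add \<Rightarrow> 'z::ab_group_add"
  assumes t: "t \<in> tensors (bilin sA sB (*)) W" and \<phi>: "lform s \<phi>"
    and "\<And>\<phi> b. lform s \<phi> \<Longrightarrow> lform sA (\<lambda>a. \<phi> (f a b))" "\<And>\<phi> a. lform s \<phi> \<Longrightarrow> lform sB (\<lambda>b. \<phi> (f a b))"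
  shows "\<phi> (ext2 sA sB s f t) = bsum sA sB t (\<lambda>a b. \<phi> (f a b))"
  by (subst lin_ext_tsum[OF t \<phi>]) (use assms(3,4) in \<open>auto simp: bilin_def case_prod_unfold\<close>)

lemma ext2_apply:
  assumes t: "t \<in> tensors (bilin sA sB (*)) W"
    and "\<And>b \<beta>. lform sA (\<lambda>a. f a b \<beta>)" "\<And>a \<beta>. lform sB (\<lambda>b. f a b \<beta>)"
  shows "ext2 sA sB fscale f t \<beta> = bsum sA sB t (\<lambda>a b. f a b \<beta>)"
proof -
  have "vector_space sA" "vector_space sB" using assms(2,3) lform_space by blast+
  then show ?thesis
    by (subst lin_ext_eval[OF pointwise_bilin t])
      (use assms(2,3) in \<open>auto simp: bilin_def case_prod_unfold\<close>)
qed

context coalgebra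
begin

abbreviation sw :: "'c \<Rightarrow> ('c \<Rightarrow> 'c \<Rightarrow> 'k) \<Rightarrow> 'k" where
  "sw h F \<equiv> bsum s s (\<Delta> h) F"

lemma vs: "vector_space s" by unfold_locales

lemmas lform_sw = lform_bsum[OF comult_linear comult_closed]
lemmas ext2_eval = ext2_apply[OF comult_closed]

lemma lform_counit: "Vector_Spaces.linear t s g \<Longrightarrow> lform t (\<lambda>x. \<epsilon> (g x))"
  by (rule linear_comp[OF _ counit_linear])

lemma sw_coassoc:
  assumes F: "\<And>b c. lform s (\<lambda>a. F a b c)" "\<And>a c. lform s (\<lambda>b. F a b c)" "\<And>a b. lform s (\<lambda>c. F a b c)"
  shows "sw h (\<lambda>a b. sw a (\<lambda>a1 a2. F a1 a2 b)) = sw h (\<lambda>a b. sw b (\<lambda>b1 b2. F a b1 b2))"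
proof -
  let ?\<beta> = "\<lambda>(a, b, c). F a b c"
  note [simp] = lform_ptens3[OF vs vs vs] ext2_eval lform_sw[OF _ _ linear_self[OF vs]] lform_bsum_arg
  have tri: "trilin s s s (*) ?\<beta>" using F by (rule trilinI)
  then have *: "tens3 s s s a b c ?\<beta> = F a b c" for a b c
    by (simp add: ptens_def)
  from arg_cong[OF coassoc[of h], where f = "\<lambda>t. t ?\<beta>"] show ?thesis
    by (simp add: *)
qed

lemma lform_scale: "lform s \<phi> \<Longrightarrow> \<phi> (s c x) = c * \<phi> x"
  by (simp add: Vector_Spaces.linear_iff)

lemma sw_counit_left:
  assumes "lform s f" shows "sw h (\<lambda>a b. \<epsilon> a * f b) = f h"
proof -
  have "f (ext2 s s s (\<lambda>a b. s (\<epsilon> a) b) (\<Delta> h)) = sw h (\<lambda>a b. f (s (\<epsilon> a) b))"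
    by (rule apply_ext2[OF comult_closed assms]) (simp_all add: lform_scale lform_mult_right counit_linear lform_mult_left)
  then show ?thesis by (simp add: counit_left lform_scale[OF assms])
qed

lemma sw_counit_right:
  assumes "lform s f" shows "sw h (\<lambda>a b. \<epsilon> b * f a) = f h"
proof -
  have "f (ext2 s s s (\<lambda>a b. s (\<epsilon> b) a) (\<Delta> h)) = sw h (\<lambda>a b. f (s (\<epsilon> b) a))"
    by (rule apply_ext2[OF comult_closed assms]) (simp_all add: lform_scale lform_mult_right counit_linear lform_mult_left)
  then show ?thesis by (simp add: counit_right lform_scale[OF assms])
qed

end

context hopf_algebra
begin

lemma linear_times_right: "Vector_Spaces.linear t s g \<Longrightarrow> Vector_Spaces.linear t s (\<lambda>x. c * g x)"
  by (auto simp: Vector_Spaces.linear_iff algebra_simps scale_mult_right)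

lemma linear_times_left: "Vector_Spaces.linear t s g \<Longrightarrow> Vector_Spaces.linear t s (\<lambda>x. g x * c)"
  by (auto simp: Vector_Spaces.linear_iff algebra_simps scale_mult_left)

lemma linear_S: "Vector_Spaces.linear t s g \<Longrightarrow> Vector_Spaces.linear t s (\<lambda>x. S (g x))"
  by (rule linear_comp[OF _ antipode_linear])

lemma lform_app: "lform s f \<Longrightarrow> Vector_Spaces.linear t s g \<Longrightarrow> lform t (\<lambda>x. f (g x))"
  by (rule linear_comp)

lemmas lin_rules = lform_sw lform_bsum_arg lform_mult_left lform_mult_right lform_counit
  linear_self[OF vs] linear_times_left linear_times_right linear_S

lemma sw_mult:
  assumes F: "\<And>b. lform s (\<lambda>a. F a b)" "\<And>a. lform s (\<lambda>b. F a b)"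
  shows "sw (x * y) F = sw x (\<lambda>a b. sw y (\<lambda>c d. F (a * c) (b * d)))"
proof -
  let ?\<beta> = "\<lambda>(a, b). F a b"
  note F' = F[THEN lform_app]
  note * = lform_app[OF lform_ptens2(1)[OF vs vs]] lform_app[OF lform_ptens2(2)[OF vs vs]]
  have "sw (x * y) F = \<Delta> (x * y) ?\<beta>" by (rule bsum_eval[OF comult_closed]) (rule F)+
  also have "\<dots> = sw x (\<lambda>a b. ext2 s s fscale (\<lambda>c d. tens2 s s (a * c) (b * d)) (\<Delta> y) ?\<beta>)"
    unfolding comult_mult
    by (rule ext2_eval; subst ext2_eval; (intro lin_rules * allI)?)
  also have "\<dots> = sw x (\<lambda>a b. sw y (\<lambda>c d. tens2 s s (a * c) (b * d) ?\<beta>))"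
    by (subst ext2_eval) (intro lin_rules * refl)+
  finally show ?thesis using bilinI[of s F, OF F] by (simp add: ptens_def)
qed

lemma sw_one:
  assumes F: "\<And>b. lform s (\<lambda>a. F a b)" "\<And>a. lform s (\<lambda>b. F a b)"
  shows "sw 1 F = F 1 1"
  using bilinI[of s F, OF F] by (subst bsum_eval[OF comult_closed]) (simp_all add: F comult_one ptens_def)

lemma sw_antipode_left:
  assumes f: "lform s f" shows "sw h (\<lambda>a b. f (S a * b)) = \<epsilon> h * f 1"
proof -
  have "f (ext2 s s s (\<lambda>a b. S a * b) (\<Delta> h)) = sw h (\<lambda>a b. f (S a * b))"
    by (rule apply_ext2[OF comult_closed f]; erule lform_app; intro lin_rules)
  then show ?thesis by (simp add: antipode_left lform_scale[OF f])
qed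

lemma sw_antipode_right:
  assumes f: "lform s f" shows "sw h (\<lambda>a b. f (a * S b)) = \<epsilon> h * f 1"
proof -
  have "f (ext2 s s s (\<lambda>a b. a * S b) (\<Delta> h)) = sw h (\<lambda>a b. f (a * S b))"
    by (rule apply_ext2[OF comult_closed f]; erule lform_app; intro lin_rules)
  then show ?thesis by (simp add: antipode_right lform_scale[OF f])
qed

lemma counit_S: "\<epsilon> (S h) = \<epsilon> h"
proof -
  have "\<epsilon> (S h) = sw h (\<lambda>a b. \<epsilon> b * \<epsilon> (S a))"
    by (rule sw_counit_right[symmetric]) (intro lin_rules)
  also have "\<dots> = sw h (\<lambda>a b. \<epsilon> (S a * b))" by (simp add: counit_mult mult.commute)
  also have "\<dots> = \<epsilon> h" by (simp add: sw_antipode_left[OF counit_linear] counit_one)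
  finally show ?thesis .
qed

text \<open>
  The antipode reverses the comultiplication. Both \<open>\<Delta> \<circ> S\<close> and \<open>h \<mapsto> S h\<^sub>(\<^sub>2\<^sub>) \<otimes> S h\<^sub>(\<^sub>1\<^sub>)\<close> are convolution
  inverses of \<open>\<Delta>\<close>, the first from the left and the second from the right, and the usual argument
  evaluates the product of all three in two ways.
\<close>

lemma sw_S:
  assumes F: "\<And>b. lform s (\<lambda>a. F a b)" "\<And>a. lform s (\<lambda>b. F a b)"
  shows "sw (S h) F = sw h (\<lambda>a b. F (S b) (S a))"
proof -
  note F' = F[THEN lform_app]
  note rls = lin_rules F'
  \<comment> \<open>the convolution product \<open>\<Delta>(S h\<^sub>(\<^sub>1\<^sub>)) \<cdot> \<Delta>(h\<^sub>(\<^sub>2\<^sub>)) \<cdot> (S h\<^sub>(\<^sub>4\<^sub>) \<otimes> S h\<^sub>(\<^sub>3\<^sub>))\<close>, paired with \<open>F\<close>\<close>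
  define E where "E = sw h (\<lambda>a r. sw (S a) (\<lambda>p q. sw r (\<lambda>b r'. sw r' (\<lambda>c r''. sw r'' (\<lambda>d e.
    F (p * (b * S e)) (q * (c * S d)))))))"
  \<comment> \<open>multiplying the last two factors first: they cancel, first the inner pair and then the outer\<close>
  have cancel: "sw r' (\<lambda>c r''. sw r'' (\<lambda>d e. F (p * (b * S e)) (q * (c * S d)))) = F (p * (b * S r')) q"
    for r' b p q
  proof -
    have "sw r' (\<lambda>c r''. sw r'' (\<lambda>d e. F (p * (b * S e)) (q * (c * S d)))) =
        sw r' (\<lambda>c' e. sw c' (\<lambda>c d. F (p * (b * S e)) (q * (c * S d))))"
      by (rule sw_coassoc[symmetric]) (intro rls)+
    also have "\<dots> = sw r' (\<lambda>c' e. \<epsilon> c' * F (p * (b * S e)) (q * 1))"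
      by (subst sw_antipode_right[where f = "\<lambda>z. F _ (q * z)"]) (intro rls refl)+
    also have "\<dots> = F (p * (b * S r')) (q * 1)"
      by (rule sw_counit_left) (intro rls)
    finally show ?thesis by simp
  qed
  have "E = sw h (\<lambda>a r. sw (S a) (\<lambda>p q. \<epsilon> r * F (p * 1) q))"
    unfolding E_def cancel
    by (subst sw_antipode_right[where f = "\<lambda>z. F (_ * z) _"]) (intro rls refl)+
  also have "\<dots> = sw h (\<lambda>a r. \<epsilon> r * sw (S a) F)"
    by (simp add: bsum_mult_left)
  also have "\<dots> = sw (S h) F"
    by (rule sw_counit_right) (intro rls F)
  finally have 1: "E = sw (S h) F" .
  \<comment> \<open>multiplying the first two factors first: \<open>\<Delta>(S h\<^sub>(\<^sub>1\<^sub>)) \<cdot> \<Delta>(h\<^sub>(\<^sub>2\<^sub>)) = \<Delta>(S h\<^sub>(\<^sub>1\<^sub>) h\<^sub>(\<^sub>2\<^sub>)) = \<epsilon> h\<close>\<close>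
  have "E = sw h (\<lambda>a r. sw (S a) (\<lambda>p q. sw r (\<lambda>m r''. sw m (\<lambda>b c. sw r'' (\<lambda>d e.
    F (p * (b * S e)) (q * (c * S d)))))))"
    unfolding E_def by (rule bsum_cong, rule bsum_cong, rule sw_coassoc[symmetric]) (intro rls)+
  also have "\<dots> = sw h (\<lambda>a r. sw r (\<lambda>m r''. sw (S a) (\<lambda>p q. sw m (\<lambda>b c. sw r'' (\<lambda>d e.
    F (p * (b * S e)) (q * (c * S d)))))))"
    by (rule bsum_cong, rule bsum_swap)
  also have "\<dots> = sw h (\<lambda>a r. sw r (\<lambda>m r''. sw (S a * m) (\<lambda>u v. sw r'' (\<lambda>d e. F (u * S e) (v * S d)))))"
    by (subst sw_mult) (simp only: mult.assoc | intro rls)+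
  also have "\<dots> = sw h (\<lambda>k r''. sw k (\<lambda>a m. sw (S a * m) (\<lambda>u v. sw r'' (\<lambda>d e. F (u * S e) (v * S d)))))"
    by (rule sw_coassoc[symmetric]) (intro rls)+
  also have "\<dots> = sw h (\<lambda>k r''. \<epsilon> k * sw 1 (\<lambda>u v. sw r'' (\<lambda>d e. F (u * S e) (v * S d))))"
    by (subst sw_antipode_left[where f = "\<lambda>z. sw z (\<lambda>u v. sw _ (\<lambda>d e. F (u * S e) (v * S d)))"])
      (intro rls refl)+
  also have "\<dots> = sw 1 (\<lambda>u v. sw h (\<lambda>d e. F (u * S e) (v * S d)))"
    by (rule sw_counit_left) (intro rls)
  also have "\<dots> = sw h (\<lambda>d e. F (S e) (S d))"
    by (subst sw_one) (simp | intro rls)+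
  finally show ?thesis using 1 by simp
qed

end

section \<open>The inverse antipode and the coaction\<close>

locale hopf_comodule = hopf_algebra s \<Delta> \<epsilon> S + left_comodule s \<Delta> \<epsilon> sY \<rho>
  for s :: "'k::field \<Rightarrow> 'h::ring_1 \<Rightarrow> 'h" and \<Delta> \<epsilon> S and sY :: "'k \<Rightarrow> 'y::ab_group_add \<Rightarrow> 'y" and \<rho> +
  assumes bij_S: "bij S"
begin

abbreviation "Sinv \<equiv> inv S"

lemma S_Sinv [simp]: "S (Sinv x) = x" and Sinv_S [simp]: "Sinv (S x) = x"
  using bij_S by (simp_all add: bij_is_surj bij_is_inj surj_f_inv_f)

lemma linear_Sinv_self: "Vector_Spaces.linear s s Sinv"
proof -
  have "S (Sinv x + Sinv y) = x + y" for x y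
    using antipode_linear by (simp add: Vector_Spaces.linear_iff)
  from arg_cong[OF this, of Sinv] have "Sinv (x + y) = Sinv x + Sinv y" for x y by simp
  moreover have "S (s c (Sinv x)) = s c x" for c x
    using antipode_linear by (simp add: Vector_Spaces.linear_iff)
  from arg_cong[OF this, of Sinv] have "Sinv (s c x) = s c (Sinv x)" for c x by simp
  ultimately show ?thesis by (simp add: Vector_Spaces.linear_iff vs)
qed

lemma linear_Sinv: "Vector_Spaces.linear t s g \<Longrightarrow> Vector_Spaces.linear t s (\<lambda>x. Sinv (g x))"
  by (rule linear_comp[OF _ linear_Sinv_self])

text \<open>
  \<open>\<Delta> h\<close> is rewritten as \<open>\<Delta> (S g)\<close> with \<open>g = S\<^sup>-\<^sup>1 h\<close>. This reduces the identities for the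
  inverse antipode to those for \<open>S\<close>, as \<open>S\<close> reverses the comultiplication.
\<close>

lemma sw_Sinv_flip:
  assumes F: "\<And>b. lform s (\<lambda>a. F a b)" "\<And>a. lform s (\<lambda>b. F a b)"
  shows "sw h F = sw (Sinv h) (\<lambda>a b. F (S b) (S a))"
  using sw_S[of F "Sinv h"] F by simp

lemma sw_Sinv:
  assumes F: "\<And>b. lform s (\<lambda>a. F a b)" "\<And>a. lform s (\<lambda>b. F a b)"
  shows "sw (Sinv h) F = sw h (\<lambda>a b. F (Sinv b) (Sinv a))"
  using sw_Sinv_flip[of "\<lambda>a b. F (Sinv b) (Sinv a)" h]
  by (simp add: F[THEN lform_app] linear_Sinv_self)

lemma counit_Sinv: "\<epsilon> (Sinv h) = \<epsilon> h"
  using counit_S[of "Sinv h"] by simp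

lemma sw_Sinv_right:
  assumes f: "lform s f" shows "sw h (\<lambda>a b. f (b * Sinv a)) = \<epsilon> h * f 1"
  using sw_antipode_left[OF f, of "Sinv h"]
  by (subst sw_Sinv_flip) (intro lin_rules lform_app[OF f] linear_Sinv | simp add: counit_Sinv)+

lemma sw_Sinv_left:
  assumes f: "lform s f" shows "sw h (\<lambda>a b. f (Sinv b * a)) = \<epsilon> h * f 1"
  using sw_antipode_right[OF f, of "Sinv h"]
  by (subst sw_Sinv_flip) (intro lin_rules lform_app[OF f] linear_Sinv | simp add: counit_Sinv)+

abbreviation sy :: "'y \<Rightarrow> ('h \<Rightarrow> 'y \<Rightarrow> 'k) \<Rightarrow> 'k" where
  "sy y F \<equiv> bsum s sY (\<rho> y) F"

lemma vsY: "vector_space sY" by unfold_locales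

lemmas lform_sy = lform_bsum[OF coact_linear coact_closed]
lemmas ext2_eval_sy = ext2_apply[OF coact_closed]

lemma sy_coassoc:
  assumes F: "\<And>b c. lform s (\<lambda>a. F a b c)" "\<And>a c. lform s (\<lambda>b. F a b c)" "\<And>a b. lform sY (\<lambda>c. F a b c)"
  shows "sy y (\<lambda>c y'. sw c (\<lambda>c1 c2. F c1 c2 y')) = sy y (\<lambda>c y'. sy y' (\<lambda>c' y''. F c c' y''))"
proof -
  let ?\<beta> = "\<lambda>(a, b, c). F a b c"
  note [simp] = lform_ptens3[OF vs vs vsY] ext2_eval ext2_eval_sy lform_sw[OF _ _ linear_self[OF vs]]
    lform_sy[OF _ _ linear_self[OF vsY]] lform_bsum_arg
  have tri: "trilin s s sY (*) ?\<beta>" using F by (rule trilinI)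
  then have *: "tens3 s s sY a b c ?\<beta> = F a b c" for a b c
    by (simp add: ptens_def)
  from arg_cong[OF coact_coassoc[of y], where f = "\<lambda>t. t ?\<beta>"] show ?thesis
    by (simp add: *)
qed

lemma sy_counit:
  assumes f: "lform sY f" shows "sy y (\<lambda>c y'. \<epsilon> c * f y') = f y"
proof -
  have scl: "\<phi> (sY c x) = c * \<phi> x" if "lform sY \<phi>" for \<phi> c x
    using that by (simp add: Vector_Spaces.linear_iff)
  have "f (ext2 s sY sY (\<lambda>c y'. sY (\<epsilon> c) y') (\<rho> y)) = sy y (\<lambda>c y'. f (sY (\<epsilon> c) y'))"
    by (rule apply_ext2[OF coact_closed f]) (simp_all add: scl lform_mult_right counit_linear lform_mult_left)
  then show ?thesis by (simp add: coact_counit scl[OF f])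
qed

end

section \<open>Multilinear forms on lists\<close>

text \<open>
  A list in which the variable occurs in exactly one place, and linearly there; these are the lists
  along which a multilinear form is linear. The closure rules let linearity of composite expressions
  be derived from their syntax.
\<close>

definition slot :: "('k::field \<Rightarrow> 'v::ab_group_add \<Rightarrow> 'v) \<Rightarrow> ('k \<Rightarrow> 'h::ab_group_add \<Rightarrow> 'h) \<Rightarrow> ('v \<Rightarrow> 'h list) \<Rightarrow> bool" where
  "slot t s L \<longleftrightarrow> (\<exists>us vs g. Vector_Spaces.linear t s g \<and> L = (\<lambda>x. us @ g x # vs))"

lemma slotE:
  assumes "slot t s L"
  obtains us vs g where "Vector_Spaces.linear t s g" "L = (\<lambda>x. us @ g x # vs)"
  using assms unfolding slot_def by blast

lemma slotI: "Vector_Spaces.linear t s g \<Longrightarrow> L = (\<lambda>x. us @ g x # vs) \<Longrightarrow> slot t s L"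
  unfolding slot_def by blast

lemma slot_here: "Vector_Spaces.linear t s g \<Longrightarrow> slot t s (\<lambda>x. g x # vs)"
  by (rule slotI[where us = "[]"]) auto

lemma slot_append_left: "slot t s L \<Longrightarrow> slot t s (\<lambda>x. ks @ L x)"
  by (erule slotE, rule slotI[where us = "ks @ _"]) auto

lemma slot_Cons: "slot t s L \<Longrightarrow> slot t s (\<lambda>x. u # L x)"
  using slot_append_left[of t s L "[u]"] by simp

lemma slot_append_right: "slot t s L \<Longrightarrow> slot t s (\<lambda>x. L x @ ks)"
  by (erule slotE, rule slotI[where vs = "_ @ ks"]) auto

lemmas slot_rules = slot_here slot_Cons slot_append_left slot_append_right

abbreviation mlform :: "('k::field \<Rightarrow> 'h::ab_group_add \<Rightarrow> 'h) \<Rightarrow> ('h list \<Rightarrow> 'k) \<Rightarrow> bool" where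
  "mlform s F \<equiv> multilin s (*) F"

lemma lform_slot: "mlform s F \<Longrightarrow> slot t s L \<Longrightarrow> lform t (\<lambda>x. F (L x))"
  by (erule slotE) (auto simp: multilin_def intro: linear_comp)

lemma mlformI: "(\<And>us vs. lform s (\<lambda>h. F (us @ h # vs))) \<Longrightarrow> mlform s F"
  by (simp add: multilin_def)

context coalgebra
begin

definition comult_at :: "nat \<Rightarrow> ('c list \<Rightarrow> 'k) \<Rightarrow> 'c list \<Rightarrow> 'k" where
  "comult_at j F hs = sw (hs ! j) (\<lambda>a b. F (take j hs @ a # b # drop (Suc j) hs))"

lemma comult_at_append: "length us = j \<Longrightarrow> comult_at j F (us @ h # ws) = sw h (\<lambda>a b. F (us @ a # b # ws))"
  by (auto simp: comult_at_def)

lemma comult_at_Cons: "comult_at (Suc j) F (h # hs) = comult_at j (\<lambda>ks. F (h # ks)) hs"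
  by (simp add: comult_at_def)

lemma comult_at_0: "comult_at 0 F (h # hs) = sw h (\<lambda>a b. F (a # b # hs))"
  by (simp add: comult_at_def)

text \<open>
  This has to hold on lists of every length, including those too short to have a place \<open>j\<close>. There
  \<open>hs ! j\<close> is an unspecified value, but it depends only on the number of places by which the list is
  too short, hence not on its entries.
\<close>

lemma mlform_comult_at:
  assumes F: "mlform s F"
  shows "mlform s (comult_at j F)"
proof (rule mlformI)
  fix us ws :: "'c list"
  note r = lform_slot[OF F] slot_rules linear_self[OF vs] lform_bsum_arg
  consider "j < length us" | "j = length us" | "j > length us" by linarith
  then show "lform s (\<lambda>h. comult_at j F (us @ h # ws))"
  proof cases
    case 1
    then have "comult_at j F (us @ h # ws) =
        sw (us ! j) (\<lambda>a b. F (take j us @ a # b # (drop (Suc j) us @ h # ws)))" for h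
      by (simp add: comult_at_def nth_append)
    then show ?thesis by (simp only:) (intro r)
  next
    case 2
    then show ?thesis by (simp only: comult_at_append) (intro lform_sw r)
  next
    case 3
    then obtain m where "j = Suc (length us + m)" using less_imp_Suc_add by blast
    then have "comult_at j F (us @ h # ws) =
        sw (ws ! m) (\<lambda>a b. F (us @ h # (take m ws @ a # b # drop (Suc m) ws)))" for h
      by (simp add: comult_at_def nth_append)
    then show ?thesis by (simp only:) (intro r)
  qed
qed

end

section \<open>The diagonal right action\<close>

context hopf_algebra
begin

text \<open>
  The value of the form \<open>F\<close> on \<open>(h\<^sup>1 \<otimes> \<dots> \<otimes> h\<^sup>n) \<cdot> g\<close>, by recursion on the number of factors. Starting
  the recursion at 0 with the counit, and not at 1, removes the separate case of one factor from all
  later inductions; the counit axiom makes the two versions agree (\<open>diag_single\<close>).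
\<close>

fun diag :: "'h list \<Rightarrow> 'h \<Rightarrow> ('h list \<Rightarrow> 'k) \<Rightarrow> 'k" where
  "diag [] g F = \<epsilon> g * F []"
| "diag (h # hs) g F = sw g (\<lambda>a b. diag hs b (\<lambda>gs. F ((h * a) # gs)))"

lemma diag_cong: "(\<And>gs. length gs = length hs \<Longrightarrow> F gs = G gs) \<Longrightarrow> diag hs g F = diag hs g G"
proof (induction hs arbitrary: g F G)
  case (Cons h hs)
  show ?case unfolding diag.simps by (intro bsum_cong Cons.IH Cons.prems) simp
qed simp

lemma lform_diag_arg: "(\<And>gs. lform t (\<lambda>x. F x gs)) \<Longrightarrow> lform t (\<lambda>x. diag hs g (F x))"
proof (induction hs arbitrary: g F)
  case Nil
  then show ?case by (simp add: lform_mult_left)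
next
  case (Cons h hs)
  show ?case unfolding diag.simps by (intro lform_bsum_arg Cons.IH Cons.prems)
qed

lemma diag_bsum: "diag hs g (\<lambda>gs. bsum sA sB t (\<lambda>a b. F gs a b)) = bsum sA sB t (\<lambda>a b. diag hs g (\<lambda>gs. F gs a b))"
proof (induction hs arbitrary: g F)
  case Nil
  show ?case by (simp add: bsum_mult_left)
next
  case (Cons h hs)
  show ?case by (simp only: diag.simps Cons.IH) (rule bsum_swap)
qed

lemma mlform_Cons: "mlform s F \<Longrightarrow> mlform s (\<lambda>gs. F (h # gs))"
  by (rule mlformI) (auto intro!: lform_slot slot_rules linear_self vs)

lemma lform_diag:
  assumes "mlform s F" "Vector_Spaces.linear t s g"
  shows "lform t (\<lambda>x. diag hs (g x) F)"
proof -
  have "lform s (\<lambda>x. diag hs x F)"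
    using assms(1)
  proof (induction hs arbitrary: F)
    case Nil
    then show ?case by (simp add: lform_mult_right counit_linear)
  next
    case (Cons h hs)
    show ?case unfolding diag.simps
      by (intro lform_sw Cons.IH lform_diag_arg mlform_Cons Cons.prems lform_slot[OF Cons.prems] slot_rules lin_rules)
  qed
  from linear_comp[OF assms(2) this] show ?thesis .
qed

lemma lform_diag_slot:
  assumes "mlform s F" "slot t s L"
  shows "lform t (\<lambda>x. diag (L x) g F)"
proof -
  from assms(2) obtain us ws k where k: "Vector_Spaces.linear t s k" and L: "L = (\<lambda>x. us @ k x # ws)"
    by (rule slotE)
  have "lform t (\<lambda>x. diag (us @ k x # ws) g F)"
    using assms(1)
  proof (induction us arbitrary: g F)
    case Nil
    show ?case unfolding append_Nil diag.simps
      by (intro lform_bsum_arg lform_diag_arg lform_slot[OF Nil] slot_rules linear_times_left k)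
  next
    case (Cons u us)
    show ?case unfolding append_Cons diag.simps
      by (intro lform_bsum_arg Cons.IH mlform_Cons Cons.prems)
  qed
  then show ?thesis by (simp only: L)
qed

lemma mlform_append: "mlform s F \<Longrightarrow> mlform s (\<lambda>gs. F (ks @ gs))" "mlform s F \<Longrightarrow> mlform s (\<lambda>gs. F (gs @ ks))"
  by (rule mlformI, auto intro!: lform_slot slot_rules linear_self vs)+

lemma diag_append:
  assumes "mlform s F"
  shows "diag (us @ ws) g F = sw g (\<lambda>a b. diag us a (\<lambda>gs. diag ws b (\<lambda>ks. F (gs @ ks))))"
  using assms
proof (induction us arbitrary: g F)
  case Nil
  show ?case
    by (simp add: sw_counit_left lform_diag[OF Nil linear_self[OF vs]])
next
  case (Cons u us)
  note F = Cons.prems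
  have "diag ((u # us) @ ws) g F =
      sw g (\<lambda>a b. sw b (\<lambda>b1 b2. diag us b1 (\<lambda>gs. diag ws b2 (\<lambda>ks. F ((u * a) # gs @ ks)))))"
    by (simp add: Cons.IH[OF mlform_Cons[OF F]])
  also have "\<dots> = sw g (\<lambda>p q. sw p (\<lambda>a b1. diag us b1 (\<lambda>gs. diag ws q (\<lambda>ks. F ((u * a) # gs @ ks)))))"
    by (rule sw_coassoc[symmetric])
      (intro lform_diag_arg lform_diag mlformI lform_slot[OF F] slot_rules lin_rules)+
  finally show ?case by simp
qed

lemma diag_single:
  assumes "lform s (\<lambda>x. F [x])" shows "diag [h] g F = F [h * g]"
  by (simp, rule sw_counit_right[where f = "\<lambda>a. F [h * a]"]) (intro lform_app[OF assms] lin_rules)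

lemma diag_snoc:
  assumes F: "mlform s F"
  shows "diag (hs @ [h]) g F = sw g (\<lambda>a b. diag hs a (\<lambda>gs. F (gs @ [h * b])))"
  by (simp only: diag_append[OF F], intro bsum_cong diag_cong diag_single)
    (intro lform_slot[OF F] slot_rules linear_self vs)

lemma diag_one:
  assumes "mlform s F" shows "diag hs 1 F = F hs"
  using assms
proof (induction hs arbitrary: F)
  case Nil
  show ?case by (simp add: counit_one)
next
  case (Cons h hs)
  have "diag (h # hs) 1 F = diag hs 1 (\<lambda>gs. F ((h * 1) # gs))"
    unfolding diag.simps
    by (rule sw_one) (intro lform_diag_arg lform_diag mlform_Cons Cons.prems lform_slot[OF Cons.prems] slot_rules lin_rules)+
  then show ?case by (simp add: Cons.IH[OF mlform_Cons[OF Cons.prems]])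
qed

lemma diag_mult:
  assumes "mlform s F" shows "diag hs (g * h) F = diag hs g (\<lambda>gs. diag gs h F)"
  using assms
proof (induction hs arbitrary: g h F)
  case Nil
  show ?case by (simp add: counit_mult)
next
  case (Cons x hs)
  note F = Cons.prems
  have "diag (x # hs) (g * h) F =
      sw g (\<lambda>a b. sw h (\<lambda>c d. diag hs (b * d) (\<lambda>gs. F ((x * (a * c)) # gs))))"
    unfolding diag.simps
    by (rule sw_mult) (intro lform_diag_arg lform_diag mlform_Cons F lform_slot[OF F] slot_rules lin_rules)+
  also have "\<dots> = sw g (\<lambda>a b. diag hs b (\<lambda>gs. sw h (\<lambda>c d. diag gs d (\<lambda>ks. F ((x * a * c) # ks)))))"
    by (simp only: Cons.IH[OF mlform_Cons[OF F]] diag_bsum mult.assoc)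
  finally show ?case by simp
qed

text \<open>
  The action commutes with comultiplying the factor in one place because \<open>\<Delta>\<close> is multiplicative:
  \<open>\<Delta>(x a) = x\<^sub>(\<^sub>1\<^sub>) a\<^sub>(\<^sub>1\<^sub>) \<otimes> x\<^sub>(\<^sub>2\<^sub>) a\<^sub>(\<^sub>2\<^sub>)\<close>, and the two new components of \<open>a\<close> are absorbed by
  coassociativity.
\<close>

lemma diag_comult_at:
  assumes "mlform s F" "length us = j"
  shows "diag (us @ x # ws) g (comult_at j F) = sw x (\<lambda>x1 x2. diag (us @ x1 # x2 # ws) g F)"
  using assms
proof (induction us arbitrary: g F j)
  case Nil
  note F = Nil.prems(1)
  have "diag ([] @ x # ws) g (comult_at j F) =
     sw g (\<lambda>a b. diag ws b (\<lambda>gs. sw x (\<lambda>x1 x2. sw a (\<lambda>a1 a2. F ((x1 * a1) # (x2 * a2) # gs)))))"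
    using Nil.prems(2)
    by (simp add: comult_at_0, intro bsum_cong diag_cong sw_mult)
      (intro lform_slot[OF F] slot_rules lin_rules)+
  also have "\<dots> = sw x (\<lambda>x1 x2. sw g (\<lambda>a b. sw a (\<lambda>a1 a2. diag ws b (\<lambda>gs. F ((x1 * a1) # (x2 * a2) # gs)))))"
    unfolding diag_bsum by (rule bsum_swap)
  also have "\<dots> = sw x (\<lambda>x1 x2. sw g (\<lambda>a1 r. sw r (\<lambda>a2 b. diag ws b (\<lambda>gs. F ((x1 * a1) # (x2 * a2) # gs)))))"
    by (rule bsum_cong, rule sw_coassoc) (intro lform_diag_arg lform_diag mlform_Cons F lform_slot[OF F] slot_rules lin_rules)+
  finally show ?case by simp
next
  case (Cons u us)
  then obtain i where i: "j = Suc i" "length us = i" by (cases j) auto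
  note F = Cons.prems(1)
  have "diag ((u # us) @ x # ws) g (comult_at j F) =
      sw g (\<lambda>a b. sw x (\<lambda>x1 x2. diag (us @ x1 # x2 # ws) b (\<lambda>gs. F ((u * a) # gs))))"
    by (simp add: i comult_at_Cons Cons.IH[OF mlform_Cons[OF F] i(2)])
  also have "\<dots> = sw x (\<lambda>x1 x2. sw g (\<lambda>a b. diag (us @ x1 # x2 # ws) b (\<lambda>gs. F ((u * a) # gs))))"
    by (rule bsum_swap)
  finally show ?case by simp
qed

end

context hopf_comodule
begin

section \<open>The explicit maps on forms\<close>

abbreviation "Tform \<beta> \<equiv> multilinT s sY (*) \<beta>"
abbreviation "Bform \<beta> \<equiv> multilinB s s sY (*) \<beta>"

lemma TformI:
  "(\<And>us ws y. lform s (\<lambda>h. \<beta> (us @ h # ws, y))) \<Longrightarrow> (\<And>hs. lform sY (\<lambda>y. \<beta> (hs, y))) \<Longrightarrow> Tform \<beta>"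
  by (simp add: multilinT_def)

lemma Tform_mlform: "Tform \<beta> \<Longrightarrow> mlform s (\<lambda>hs. \<beta> (hs, y))"
  by (simp add: multilinT_def multilin_def)

lemma Tform_slot: "Tform \<beta> \<Longrightarrow> slot t s L \<Longrightarrow> lform t (\<lambda>x. \<beta> (L x, y))"
  using lform_slot[OF Tform_mlform] .

lemma Tform_module: "Tform \<beta> \<Longrightarrow> Vector_Spaces.linear t sY g \<Longrightarrow> lform t (\<lambda>x. \<beta> (hs, g x))"
  by (auto simp: multilinT_def intro: linear_comp[where g = "\<lambda>y. \<beta> (hs, y)"])

lemma BformI:
  "(\<And>cs y. lform s (\<lambda>x. \<beta> (x, cs, y))) \<Longrightarrow> (\<And>x us ws y. lform s (\<lambda>h. \<beta> (x, us @ h # ws, y))) \<Longrightarrow>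
   (\<And>x cs. lform sY (\<lambda>y. \<beta> (x, cs, y))) \<Longrightarrow> Bform \<beta>"
  by (simp add: multilinB_def)

lemma Bform_mlform: "Bform \<beta> \<Longrightarrow> mlform s (\<lambda>cs. \<beta> (x, cs, y))"
  by (simp add: multilinB_def multilin_def)

lemma Bform_slot: "Bform \<beta> \<Longrightarrow> slot t s L \<Longrightarrow> lform t (\<lambda>z. \<beta> (x, L z, y))"
  using lform_slot[OF Bform_mlform] .

lemma Bform_head: "Bform \<beta> \<Longrightarrow> Vector_Spaces.linear t s g \<Longrightarrow> lform t (\<lambda>x. \<beta> (g x, cs, y))"
  by (auto simp: multilinB_def intro: linear_comp[where g = "\<lambda>x. \<beta> (x, cs, y)"])

lemma Bform_module: "Bform \<beta> \<Longrightarrow> Vector_Spaces.linear t sY g \<Longrightarrow> lform t (\<lambda>z. \<beta> (x, cs, g z))"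
  by (auto simp: multilinB_def intro: linear_comp[where g = "\<lambda>y. \<beta> (x, cs, y)"])

lemmas form_rules = lin_rules lform_sy linear_self[OF vsY] linear_Sinv slot_rules
  lform_diag_arg lform_diag lform_diag_slot

subsection \<open>Transposed maps\<close>

text \<open>
  Each of the following is the transpose of a linear map: \<open>tauF\<close> of \<open>\<tau>\<close>, \<open>rotF\<close> of \<open>\<tau>\<^sup>-\<^sup>1\<close>,
  \<open>TdF n j\<close> and \<open>BdF n j\<close> of the explicit cofaces, \<open>PhiF\<close> and \<open>PsiF\<close> of the two inverse isomorphisms.
  A transpose sends a form on the target to its pullback, so composites appear in the reversed order.
\<close>

definition tauF where
  "tauF \<beta> = (\<lambda>(hs, y). sy y (\<lambda>a y'. \<beta> ((Sinv a * last hs) # butlast hs, y')))"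

definition rotF where
  "rotF \<beta> = (\<lambda>(hs, y). sy y (\<lambda>a y'. \<beta> (tl hs @ [a * hd hs], y')))"

definition TdF where
  "TdF n j \<beta> = (\<lambda>(hs, y).
     if j \<le> n then comult_at j (\<lambda>ks. \<beta> (ks, y)) hs
     else sw (hd hs) (\<lambda>a b. sy y (\<lambda>c y'. \<beta> (b # tl hs @ [c * a], y'))))"

definition BdF where
  "BdF n j \<beta> = (\<lambda>(x, cs, y).
     if j = 0 then sw x (\<lambda>a r. sw r (\<lambda>b c. \<beta> (b, (c * S a) # cs, y)))
     else if j \<le> n then comult_at (j - 1) (\<lambda>ks. \<beta> (x, ks, y)) cs
     else sy y (\<lambda>c y'. \<beta> (x, cs @ [c], y')))"

definition PhiF where
  "PhiF \<beta> = (\<lambda>(hs, y). sw (hd hs) (\<lambda>a b. diag (tl hs) (S a) (\<lambda>gs. \<beta> (b, gs, y))))"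

definition PsiF where
  "PsiF \<beta> = (\<lambda>(x, cs, y). sw x (\<lambda>a b. diag cs a (\<lambda>gs. \<beta> (b # gs, y))))"

lemma Tform_tauF: assumes "Tform \<beta>" shows "Tform (tauF \<beta>)"
proof (rule TformI)
  note r = Tform_slot[OF assms] Tform_module[OF assms] form_rules
  show "lform sY (\<lambda>y. tauF \<beta> (hs, y))" for hs
    unfolding tauF_def prod.case by (intro r)
  show "lform s (\<lambda>h. tauF \<beta> (us @ h # ws, y))" for us ws y
  proof (cases ws rule: rev_cases)
    case Nil
    then show ?thesis unfolding tauF_def prod.case by (simp add: butlast_append) (intro r)
  next
    case (snoc ws' w)
    then show ?thesis unfolding tauF_def prod.case by (simp add: butlast_append) (intro r)
  qed
qed

lemma Tform_rotF: assumes "Tform \<beta>" shows "Tform (rotF \<beta>)"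
proof (rule TformI)
  note r = Tform_slot[OF assms] Tform_module[OF assms] form_rules
  show "lform sY (\<lambda>y. rotF \<beta> (hs, y))" for hs
    unfolding rotF_def prod.case by (intro r)
  show "lform s (\<lambda>h. rotF \<beta> (us @ h # ws, y))" for us ws y
    unfolding rotF_def prod.case by (cases us) (simp; intro r)+
qed

lemma lform_comult_at_arg: "(\<And>ks. lform t (\<lambda>x. F x ks)) \<Longrightarrow> lform t (\<lambda>x. comult_at j (F x) hs)"
  unfolding comult_at_def by (intro lform_bsum_arg)

lemma Tform_TdF: assumes "Tform \<beta>" shows "Tform (TdF n j \<beta>)"
proof (cases "j \<le> n")
  case True
  then have "TdF n j \<beta> (hs, y) = comult_at j (\<lambda>ks. \<beta> (ks, y)) hs" for hs y by (simp add: TdF_def)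
  then show ?thesis
    by (intro TformI; simp only:)
      (intro lform_slot[OF mlform_comult_at[OF Tform_mlform[OF assms]]] lform_comult_at_arg
        Tform_module[OF assms] form_rules)+
next
  case False
  note r = Tform_slot[OF assms] Tform_module[OF assms] form_rules
  from False have *: "TdF n j \<beta> (hs, y) = sw (hd hs) (\<lambda>a b. sy y (\<lambda>c y'. \<beta> (b # tl hs @ [c * a], y')))" for hs y
    by (simp add: TdF_def)
  show ?thesis
  proof (rule TformI; simp only: *)
    show "lform sY (\<lambda>y. sw (hd hs) (\<lambda>a b. sy y (\<lambda>c y'. \<beta> (b # tl hs @ [c * a], y'))))" for hs
      by (intro r)
    show "lform s (\<lambda>h. sw (hd (us @ h # ws)) (\<lambda>a b. sy y (\<lambda>c y'. \<beta> (b # tl (us @ h # ws) @ [c * a], y'))))" for us ws y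
      by (cases us) (simp; intro r)+
  qed
qed

lemma Bform_BdF: assumes "Bform \<beta>" shows "Bform (BdF n j \<beta>)"
proof -
  note r = Bform_slot[OF assms] Bform_module[OF assms] Bform_head[OF assms] form_rules
  note r' = lform_slot[OF mlform_comult_at[OF Bform_mlform[OF assms]]] lform_comult_at_arg r
  consider "j = 0" | "j \<noteq> 0" "j \<le> n" | "j \<noteq> 0" "\<not> j \<le> n" by blast
  then show ?thesis
  proof cases
    case 1
    show ?thesis by (rule BformI; simp add: BdF_def 1; intro r)
  next
    case 2
    show ?thesis by (rule BformI; simp add: BdF_def 2; intro r')
  next
    case 3
    show ?thesis by (rule BformI; simp add: BdF_def 3; intro r)
  qed
qed

lemma Tform_PhiF: assumes "Bform \<beta>" shows "Tform (PhiF \<beta>)"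
proof (rule TformI)
  note r = Bform_slot[OF assms] Bform_module[OF assms] Bform_head[OF assms] Bform_mlform[OF assms] form_rules
  show "lform sY (\<lambda>y. PhiF \<beta> (hs, y))" for hs
    unfolding PhiF_def prod.case by (intro r)
  show "lform s (\<lambda>h. PhiF \<beta> (us @ h # ws, y))" for us ws y
    unfolding PhiF_def prod.case by (cases us) (simp; intro r)+
qed

lemma Bform_PsiF: assumes "Tform \<beta>" shows "Bform (PsiF \<beta>)"
  unfolding PsiF_def
  by (rule BformI; simp only: prod.case;
      intro Tform_slot[OF assms] Tform_module[OF assms] mlform_Cons[OF Tform_mlform[OF assms]] form_rules)

section \<open>Identities between the transposes\<close>

text \<open>
  \<open>\<tau> \<tau>\<^sup>-\<^sup>1\<close> multiplies the first factor by \<open>S\<^sup>-\<^sup>1(y\<^sub>(\<^sub>-\<^sub>1\<^sub>)) y\<^sub>(\<^sub>-\<^sub>2\<^sub>)\<close>, which is a counit. In the other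
  order, the last factor is multiplied by \<open>y\<^sub>(\<^sub>-\<^sub>1\<^sub>) S\<^sup>-\<^sup>1(y\<^sub>(\<^sub>-\<^sub>2\<^sub>))\<close>.
\<close>

lemma rotF_tauF:
  assumes "Tform \<beta>" shows "rotF (tauF \<beta>) (h # hs, y) = \<beta> (h # hs, y)"
proof -
  note r = Tform_slot[OF assms] Tform_module[OF assms] form_rules
  have "rotF (tauF \<beta>) (h # hs, y) = sy y (\<lambda>c y'. sy y' (\<lambda>a y''. \<beta> ((Sinv a * c * h) # hs, y'')))"
    by (simp add: rotF_def tauF_def mult.assoc)
  also have "\<dots> = sy y (\<lambda>c y'. sw c (\<lambda>c1 c2. \<beta> ((Sinv c2 * c1 * h) # hs, y')))"
    by (rule sy_coassoc[symmetric]) (intro r)+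
  also have "\<dots> = sy y (\<lambda>c y'. \<epsilon> c * \<beta> ((1 * h) # hs, y'))"
    by (intro bsum_cong sw_Sinv_left[where f = "\<lambda>z. \<beta> ((z * h) # hs, _)"]) (intro r)
  also have "\<dots> = \<beta> ((1 * h) # hs, y)"
    by (rule sy_counit) (intro r)
  finally show ?thesis by simp
qed

lemma tauF_rotF:
  assumes "Tform \<beta>" shows "tauF (rotF \<beta>) (hs @ [h], y) = \<beta> (hs @ [h], y)"
proof -
  note r = Tform_slot[OF assms] Tform_module[OF assms] form_rules
  have "tauF (rotF \<beta>) (hs @ [h], y) = sy y (\<lambda>a y'. sy y' (\<lambda>c y''. \<beta> (hs @ [c * Sinv a * h], y'')))"
    by (simp add: rotF_def tauF_def mult.assoc)
  also have "\<dots> = sy y (\<lambda>c y'. sw c (\<lambda>a c. \<beta> (hs @ [c * Sinv a * h], y')))"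
    by (rule sy_coassoc[symmetric]) (intro r)+
  also have "\<dots> = sy y (\<lambda>c y'. \<epsilon> c * \<beta> (hs @ [1 * h], y'))"
    by (intro bsum_cong sw_Sinv_right[where f = "\<lambda>z. \<beta> (hs @ [z * h], _)"]) (intro r)
  also have "\<dots> = \<beta> (hs @ [1 * h], y)"
    by (rule sy_counit) (intro r)
  finally show ?thesis by simp
qed

lemma TdF_inner: "length us = j \<Longrightarrow> j \<le> n \<Longrightarrow> TdF n j \<beta> (us @ x # ws, y) = sw x (\<lambda>a b. \<beta> (us @ a # b # ws, y))"
  by (simp add: TdF_def comult_at_append)

lemma TdF_last: "n < j \<Longrightarrow> TdF n j \<beta> (h # hs, y) = sw h (\<lambda>a b. sy y (\<lambda>c y'. \<beta> (b # hs @ [c * a], y')))"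
  by (simp add: TdF_def)

lemma tauF_snoc: "tauF \<beta> (hs @ [z], y) = sy y (\<lambda>a y'. \<beta> ((Sinv a * z) # hs, y'))"
  by (simp add: tauF_def)

lemma list_split_at:
  assumes "j < length hs"
  obtains us x ws where "hs = us @ x # ws" "length us = j"
  using assms id_take_nth_drop[of j hs] by (metis length_take min.absorb4)

text \<open>
  The relation \<open>\<partial>\<^sub>j\<^sub>+\<^sub>1 \<tau> = \<tau> \<partial>\<^sub>j\<close>. For \<open>j < n\<close> both sides comultiply the same factor, which \<open>\<tau>\<close> moves by one
  place. For \<open>j = n\<close> the last coface of a rotated tensor involves
  \<open>\<Delta>(S\<^sup>-\<^sup>1(y\<^sub>(\<^sub>-\<^sub>2\<^sub>)) z)\<close> and \<open>y\<^sub>(\<^sub>-\<^sub>1\<^sub>)\<close>; since \<open>S\<^sup>-\<^sup>1\<close> reverses the comultiplication, the last factor becomes,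
  after renumbering,
  \<open>y\<^sub>(\<^sub>-\<^sub>1\<^sub>) S\<^sup>-\<^sup>1(y\<^sub>(\<^sub>-\<^sub>2\<^sub>)) z\<^sub>(\<^sub>1\<^sub>)\<close>, where the coaction cancels.
\<close>

lemma TdF_tauF:
  assumes "Tform \<beta>" "length hs = n" "j \<le> n"
  shows "TdF n j (tauF \<beta>) (hs @ [z], y) = tauF (TdF n (Suc j) \<beta>) (hs @ [z], y)"
proof (cases "j < n")
  case True
  then obtain us x ws where hs: "hs = us @ x # ws" "length us = j"
    using list_split_at assms(2) by blast
  have "TdF n j (tauF \<beta>) (hs @ [z], y) = sw x (\<lambda>a b. tauF \<beta> ((us @ a # b # ws) @ [z], y))"
    using TdF_inner[OF hs(2) assms(3), of "tauF \<beta>" x "ws @ [z]" y] by (simp add: hs)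
  also have "\<dots> = sw x (\<lambda>a b. sy y (\<lambda>c y'. \<beta> ((Sinv c * z) # us @ a # b # ws, y')))"
    by (simp only: tauF_snoc)
  also have "\<dots> = sy y (\<lambda>c y'. sw x (\<lambda>a b. \<beta> ((Sinv c * z) # us @ a # b # ws, y')))"
    by (rule bsum_swap)
  also have "\<dots> = tauF (TdF n (Suc j) \<beta>) (hs @ [z], y)"
  proof -
    have "TdF n (Suc j) \<beta> ((Sinv c * z) # hs, y') = sw x (\<lambda>a b. \<beta> ((Sinv c * z) # us @ a # b # ws, y'))" for c y'
      using TdF_inner[of "(Sinv c * z) # us" "Suc j" n \<beta> x ws y'] hs True by simp
    then show ?thesis by (simp only: tauF_snoc)
  qed
  finally show ?thesis .
next
  case False
  then have j: "j = n" using assms(3) by simp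
  note r = Tform_slot[OF assms(1)] Tform_module[OF assms(1)] form_rules
  have "tauF (TdF n (Suc j) \<beta>) (hs @ [z], y) =
      sy y (\<lambda>c y'. sw (Sinv c * z) (\<lambda>a b. sy y' (\<lambda>d y''. \<beta> (b # hs @ [d * a], y''))))"
    by (simp add: tauF_snoc TdF_last j)
  also have "\<dots> = sy y (\<lambda>c y'. sw (Sinv c) (\<lambda>c1 c2. sw z (\<lambda>a b. sy y' (\<lambda>d y''. \<beta> ((c2 * b) # hs @ [d * (c1 * a)], y'')))))"
    by (rule bsum_cong, rule sw_mult) (intro r)+
  also have "\<dots> = sy y (\<lambda>c y'. sw c (\<lambda>c1 c2. sw z (\<lambda>a b. sy y' (\<lambda>d y''. \<beta> ((Sinv c1 * b) # hs @ [d * (Sinv c2 * a)], y'')))))"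
    by (rule bsum_cong, rule sw_Sinv) (intro r)+
  also have "\<dots> = sy y (\<lambda>c1 u. sy u (\<lambda>c2 y'. sw z (\<lambda>a b. sy y' (\<lambda>d y''. \<beta> ((Sinv c1 * b) # hs @ [d * (Sinv c2 * a)], y'')))))"
    by (rule sy_coassoc) (intro r)+
  also have "\<dots> = sy y (\<lambda>c1 u. sw z (\<lambda>a b. sy u (\<lambda>c2 y'. sy y' (\<lambda>d y''. \<beta> ((Sinv c1 * b) # hs @ [d * (Sinv c2 * a)], y'')))))"
    by (rule bsum_cong, rule bsum_swap)
  also have "\<dots> = sy y (\<lambda>c1 u. sw z (\<lambda>a b. \<beta> ((Sinv c1 * b) # hs @ [a], u)))"
  proof (intro bsum_cong)
    fix c1 u a b
    have "sy u (\<lambda>c2 y'. sy y' (\<lambda>d y''. \<beta> ((Sinv c1 * b) # hs @ [d * (Sinv c2 * a)], y''))) =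
        sy u (\<lambda>e y'. sw e (\<lambda>c2 d. \<beta> ((Sinv c1 * b) # hs @ [d * Sinv c2 * a], y')))"
      by (subst sy_coassoc) (simp only: mult.assoc | intro r)+
    also have "\<dots> = sy u (\<lambda>e y'. \<epsilon> e * \<beta> ((Sinv c1 * b) # hs @ [1 * a], y'))"
      by (intro bsum_cong sw_Sinv_right[where f = "\<lambda>w. \<beta> (_ # hs @ [w * a], _)"]) (intro r)
    also have "\<dots> = \<beta> ((Sinv c1 * b) # hs @ [1 * a], u)"
      by (rule sy_counit) (intro r)
    finally show "sy u (\<lambda>c2 y'. sy y' (\<lambda>d y''. \<beta> ((Sinv c1 * b) # hs @ [d * (Sinv c2 * a)], y''))) =
      \<beta> ((Sinv c1 * b) # hs @ [a], u)" by simp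
  qed
  also have "\<dots> = sw z (\<lambda>a b. sy y (\<lambda>c1 u. \<beta> ((Sinv c1 * b) # hs @ [a], u)))"
    by (rule bsum_swap)
  also have "\<dots> = TdF n j (tauF \<beta>) (hs @ [z], y)"
    using TdF_inner[OF assms(2), of n "tauF \<beta>" z "[]" y] tauF_snoc[of \<beta> "hs @ [_]"] by (simp add: j)
  finally show ?thesis by simp
qed

text \<open>
  \<open>\<Phi> \<Psi>\<close> acts on the middle factors by \<open>x\<^sub>(\<^sub>1\<^sub>) S(x\<^sub>(\<^sub>2\<^sub>))\<close> and \<open>\<Psi> \<Phi>\<close> by \<open>S(h\<^sub>(\<^sub>1\<^sub>)) h\<^sub>(\<^sub>2\<^sub>)\<close>; both are counits.
\<close>

lemma PsiF_PhiF:
  assumes "Bform \<beta>" shows "PsiF (PhiF \<beta>) (x, cs, y) = \<beta> (x, cs, y)"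
proof -
  note m = Bform_mlform[OF assms]
  note r = Bform_slot[OF assms] Bform_module[OF assms] Bform_head[OF assms] m form_rules
  have "PsiF (PhiF \<beta>) (x, cs, y) = sw x (\<lambda>a b. sw b (\<lambda>c d. diag cs (a * S c) (\<lambda>ks. \<beta> (d, ks, y))))"
    by (simp add: PsiF_def PhiF_def diag_mult[OF m] diag_bsum)
  also have "\<dots> = sw x (\<lambda>p d. sw p (\<lambda>a c. diag cs (a * S c) (\<lambda>ks. \<beta> (d, ks, y))))"
    by (rule sw_coassoc[symmetric]) (intro r)+
  also have "\<dots> = sw x (\<lambda>p d. \<epsilon> p * diag cs 1 (\<lambda>ks. \<beta> (d, ks, y)))"
    by (rule bsum_cong, rule sw_antipode_right) (intro r)
  also have "\<dots> = diag cs 1 (\<lambda>ks. \<beta> (x, ks, y))"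
    by (rule sw_counit_left) (intro r)
  finally show ?thesis by (simp add: diag_one[OF m])
qed

lemma PhiF_PsiF:
  assumes "Tform \<beta>" shows "PhiF (PsiF \<beta>) (h # hs, y) = \<beta> (h # hs, y)"
proof -
  note m = mlform_Cons[OF Tform_mlform[OF assms]]
  note r = Tform_slot[OF assms] Tform_module[OF assms] m form_rules
  have "PhiF (PsiF \<beta>) (h # hs, y) = sw h (\<lambda>a b. sw b (\<lambda>c d. diag hs (S a * c) (\<lambda>ks. \<beta> (d # ks, y))))"
    by (simp add: PsiF_def PhiF_def diag_mult[OF m] diag_bsum)
  also have "\<dots> = sw h (\<lambda>p d. sw p (\<lambda>a c. diag hs (S a * c) (\<lambda>ks. \<beta> (d # ks, y))))"
    by (rule sw_coassoc[symmetric]) (intro r)+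
  also have "\<dots> = sw h (\<lambda>p d. \<epsilon> p * diag hs 1 (\<lambda>ks. \<beta> (d # ks, y)))"
    by (rule bsum_cong, rule sw_antipode_left) (intro r)
  also have "\<dots> = diag hs 1 (\<lambda>ks. \<beta> (h # ks, y))"
    by (rule sw_counit_left) (intro r)
  finally show ?thesis by (simp add: diag_one[OF m])
qed

text \<open>
  Below, \<open>F\<close> stands for \<open>(h\<^sup>1 \<otimes> \<dots> \<otimes> h\<^sup>n)\<close>.

  For \<open>j = 0\<close> the left side is \<open>h\<^sub>(\<^sub>2\<^sub>) \<otimes> h\<^sub>(\<^sub>3\<^sub>) S(h\<^sub>(\<^sub>1\<^sub>))\<^sub>(\<^sub>1\<^sub>) \<otimes> F \<cdot> S(h\<^sub>(\<^sub>1\<^sub>))\<^sub>(\<^sub>2\<^sub>) = h\<^sub>(\<^sub>3\<^sub>) \<otimes> h\<^sub>(\<^sub>4\<^sub>) S(h\<^sub>(\<^sub>2\<^sub>)) \<otimes> F \<cdot> S(h\<^sub>(\<^sub>1\<^sub>))\<close>,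
  in which the components \<open>h\<^sub>(\<^sub>2\<^sub>), h\<^sub>(\<^sub>3\<^sub>), h\<^sub>(\<^sub>4\<^sub>)\<close> form the coaction of \<open>coad(H)\<close> at \<open>h\<^sub>(\<^sub>2\<^sub>)\<close>.

  For \<open>j = n + 1\<close> the left side is \<open>h\<^sub>(\<^sub>3\<^sub>) \<otimes> (F \<otimes> y\<^sub>(\<^sub>-\<^sub>1\<^sub>) h\<^sub>(\<^sub>1\<^sub>)) \<cdot> S(h\<^sub>(\<^sub>2\<^sub>)) \<otimes> y\<^sub>(\<^sub>0\<^sub>)\<close>, which equals
  \<open>h\<^sub>(\<^sub>4\<^sub>) \<otimes> F \<cdot> S(h\<^sub>(\<^sub>3\<^sub>)) \<otimes> y\<^sub>(\<^sub>-\<^sub>1\<^sub>) h\<^sub>(\<^sub>1\<^sub>) S(h\<^sub>(\<^sub>2\<^sub>)) \<otimes> y\<^sub>(\<^sub>0\<^sub>)\<close>, and \<open>h\<^sub>(\<^sub>1\<^sub>) S(h\<^sub>(\<^sub>2\<^sub>))\<close> cancels.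
\<close>

lemma TdF_PhiF:
  assumes \<beta>: "Bform \<beta>" and n: "length hs = n"
  shows "TdF n j (PhiF \<beta>) (h # hs, y) = PhiF (BdF n j \<beta>) (h # hs, y)"
proof -
  note m = Bform_mlform[OF \<beta>]
  note r = Bform_slot[OF \<beta>] Bform_module[OF \<beta>] Bform_head[OF \<beta>] m mlform_append[OF m] mlform_Cons[OF m] form_rules
  have Phi: "PhiF \<gamma> (k # ks, y) = sw k (\<lambda>a b. diag ks (S a) (\<lambda>gs. \<gamma> (b, gs, y)))" for \<gamma> k ks y
    by (simp add: PhiF_def)
  consider "j = 0" | i where "j = Suc i" "j \<le> n" | "j > n" by (cases j) fastforce+
  then show ?thesis
  proof cases
    case 1
    let ?K = "\<lambda>a u b q. diag hs (S a) (\<lambda>gs. \<beta> (b, (q * S u) # gs, y))"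
    have "TdF n j (PhiF \<beta>) (h # hs, y) = sw h (\<lambda>p q. sw p (\<lambda>a b. diag (q # hs) (S a) (\<lambda>gs. \<beta> (b, gs, y))))"
      using TdF_inner[of "[]" j n "PhiF \<beta>" h hs y] 1 by (simp add: Phi)
    also have "\<dots> = sw h (\<lambda>p q. sw p (\<lambda>a b. sw a (\<lambda>a1 a2. ?K a1 a2 b q)))"
      unfolding diag.simps by (intro bsum_cong sw_S) (intro r)+
    also have "\<dots> = sw h (\<lambda>p q. sw p (\<lambda>a1 t. sw t (\<lambda>a2 b. ?K a1 a2 b q)))"
      by (rule bsum_cong, rule sw_coassoc) (intro r)+
    also have "\<dots> = sw h (\<lambda>a1 t. sw t (\<lambda>u q. sw u (\<lambda>a2 b. ?K a1 a2 b q)))"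
      by (rule sw_coassoc) (intro r)+
    also have "\<dots> = sw h (\<lambda>a1 t. sw t (\<lambda>a2 v. sw v (\<lambda>b q. ?K a1 a2 b q)))"
      by (rule bsum_cong, rule sw_coassoc) (intro r)+
    also have "\<dots> = PhiF (BdF n j \<beta>) (h # hs, y)"
      by (simp add: Phi BdF_def 1 diag_bsum)
    finally show ?thesis .
  next
    case (2 i)
    then obtain us x ws where hs: "hs = us @ x # ws" "length us = i"
      using list_split_at[of i hs] n by auto
    have "TdF n j (PhiF \<beta>) (h # hs, y) = sw x (\<lambda>x1 x2. sw h (\<lambda>a b. diag (us @ x1 # x2 # ws) (S a) (\<lambda>gs. \<beta> (b, gs, y))))"
      using TdF_inner[of "h # us" j n "PhiF \<beta>" x ws y] 2 hs by (simp add: Phi)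
    also have "\<dots> = sw h (\<lambda>a b. sw x (\<lambda>x1 x2. diag (us @ x1 # x2 # ws) (S a) (\<lambda>gs. \<beta> (b, gs, y))))"
      by (rule bsum_swap)
    also have "\<dots> = sw h (\<lambda>a b. diag hs (S a) (comult_at i (\<lambda>gs. \<beta> (b, gs, y))))"
      unfolding hs(1) by (rule bsum_cong, rule diag_comult_at[OF m hs(2), symmetric])
    also have "\<dots> = PhiF (BdF n j \<beta>) (h # hs, y)"
      using 2 by (simp add: Phi BdF_def)
    finally show ?thesis .
  next
    case 3
    let ?K = "\<lambda>z u q. sy y (\<lambda>c y'. diag hs (S u) (\<lambda>gs. \<beta> (q, gs @ [c * z], y')))"
    have "TdF n j (PhiF \<beta>) (h # hs, y) =
        sw h (\<lambda>a b. sy y (\<lambda>c y'. sw b (\<lambda>p q. diag (hs @ [c * a]) (S p) (\<lambda>gs. \<beta> (q, gs, y')))))"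
      using 3 by (simp add: TdF_last Phi)
    also have "\<dots> = sw h (\<lambda>a b. sy y (\<lambda>c y'. sw b (\<lambda>p q. sw p (\<lambda>p1 p2. diag hs (S p2) (\<lambda>gs. \<beta> (q, gs @ [c * (a * S p1)], y'))))))"
      unfolding diag_snoc[OF m] mult.assoc by (intro bsum_cong sw_S) (intro r)+
    also have "\<dots> = sw h (\<lambda>a b. sw b (\<lambda>p q. sw p (\<lambda>p1 p2. ?K (a * S p1) p2 q)))"
      by (rule bsum_cong, subst bsum_swap, rule bsum_cong, rule bsum_swap)
    also have "\<dots> = sw h (\<lambda>a b. sw b (\<lambda>p1 t. sw t (\<lambda>p2 q. ?K (a * S p1) p2 q)))"
      by (rule bsum_cong, rule sw_coassoc) (intro r)+
    also have "\<dots> = sw h (\<lambda>k t. sw k (\<lambda>a p1. sw t (\<lambda>p2 q. ?K (a * S p1) p2 q)))"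
      by (rule sw_coassoc[symmetric]) (intro r)+
    also have "\<dots> = sw h (\<lambda>k t. \<epsilon> k * sw t (\<lambda>p2 q. ?K 1 p2 q))"
      by (rule bsum_cong, rule sw_antipode_right) (intro r)
    also have "\<dots> = sw h (\<lambda>p2 q. ?K 1 p2 q)"
      by (rule sw_counit_left) (intro r)
    also have "\<dots> = PhiF (BdF n j \<beta>) (h # hs, y)"
      using 3 by (simp add: Phi BdF_def diag_bsum)
    finally show ?thesis .
  qed
qed

text \<open>
  Cofaces at different places commute, and those at the same place are related by coassociativity.
  The last coface also comultiplies the first factor, so its relation to \<open>\<partial>\<^sub>0\<close> is again coassociativity;
  its relation to itself holds because the coaction of \<open>Y\<close> is coassociative and \<open>\<Delta>\<close> is multiplicative.
\<close>

lemma TdF_cosimplicial: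
  assumes \<beta>: "Tform \<beta>" and n: "length hs = n" and ij: "i \<le> j" "j \<le> Suc n"
  shows "TdF n j (TdF (Suc n) i \<beta>) (h # hs, y) = TdF n i (TdF (Suc n) (Suc j) \<beta>) (h # hs, y)"
proof -
  note r = Tform_slot[OF \<beta>] Tform_module[OF \<beta>] form_rules
  consider "i = j" "j \<le> n" | "i < j" "j \<le> n" | "i = 0" "j = Suc n" | "0 < i" "i \<le> n" "j = Suc n" | "i = Suc n" "j = Suc n"
    using ij by linarith
  then show ?thesis
  proof cases
    case 1
    then obtain us x ws where w: "h # hs = us @ x # ws" "length us = j"
      using list_split_at[of j "h # hs"] n by auto
    have a: "TdF (Suc n) (Suc j) \<beta> (us @ a # b # ws, y) = sw b (\<lambda>b1 b2. \<beta> (us @ a # b1 # b2 # ws, y))" for a b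
      using TdF_inner[of "us @ [a]" "Suc j" "Suc n" \<beta> b ws y] 1 w by simp
    show ?thesis unfolding w(1)
      using sw_coassoc[of "\<lambda>a b c. \<beta> (us @ a # b # c # ws, y)" x] 1 w
      by (simp add: TdF_inner a) (rule sw_coassoc, (intro r)+)
  next
    case 2
    then obtain us' x ws where w': "h # hs = us' @ x # ws" "length us' = j"
      using list_split_at[of j "h # hs"] n by auto
    obtain us z vs where us: "us' = us @ z # vs" "length us = i"
      using list_split_at[of i us'] w' 2 by auto
    have "TdF n j (TdF (Suc n) i \<beta>) (h # hs, y) = sw x (\<lambda>a b. sw z (\<lambda>p q. \<beta> (us @ p # q # vs @ a # b # ws, y)))"
      using TdF_inner[OF w'(2), of n "TdF (Suc n) i \<beta>" x ws y] 2 us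
      by (simp add: w' TdF_inner)
    also have "\<dots> = sw z (\<lambda>p q. sw x (\<lambda>a b. \<beta> (us @ p # q # vs @ a # b # ws, y)))"
      by (rule bsum_swap)
    also have "\<dots> = TdF n i (TdF (Suc n) (Suc j) \<beta>) (h # hs, y)"
    proof -
      have "TdF (Suc n) (Suc j) \<beta> (us @ p # q # vs @ x # ws, y) = sw x (\<lambda>a b. \<beta> (us @ p # q # vs @ a # b # ws, y))" for p q
        using TdF_inner[of "us @ p # q # vs" "Suc j" "Suc n" \<beta> x ws y] 2 us w' by simp
      then show ?thesis using 2 us by (simp add: w' TdF_inner)
    qed
    finally show ?thesis .
  next
    case 3
    have "TdF n j (TdF (Suc n) i \<beta>) (h # hs, y) =
        sw h (\<lambda>a b. sy y (\<lambda>c y'. sw b (\<lambda>p q. \<beta> (p # q # hs @ [c * a], y'))))"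
      using TdF_inner[of "[]" 0 "Suc n"] by (simp add: 3 TdF_last)
    also have "\<dots> = sw h (\<lambda>a b. sw b (\<lambda>p q. sy y (\<lambda>c y'. \<beta> (p # q # hs @ [c * a], y'))))"
      by (rule bsum_cong, rule bsum_swap)
    also have "\<dots> = sw h (\<lambda>k q. sw k (\<lambda>a p. sy y (\<lambda>c y'. \<beta> (p # q # hs @ [c * a], y'))))"
      by (rule sw_coassoc[symmetric]) (intro r)+
    also have "\<dots> = TdF n i (TdF (Suc n) (Suc j) \<beta>) (h # hs, y)"
      using TdF_inner[of "[]" 0 n _ h hs y] by (simp add: 3 TdF_last)
    finally show ?thesis .
  next
    case 4
    then have "i - 1 < length hs" using n by simp
    then obtain us x ws where "hs = us @ x # ws" "length us = i - 1" by (rule list_split_at)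
    with 4 have w: "hs = us @ x # ws" "i = Suc (length us)" by simp_all
    have "TdF n j (TdF (Suc n) i \<beta>) (h # hs, y) =
        sw h (\<lambda>a b. sy y (\<lambda>c y'. sw x (\<lambda>p q. \<beta> (b # us @ p # q # ws @ [c * a], y'))))"
      using 4 w(2) TdF_inner[of "_ # us" i "Suc n" \<beta> x "ws @ [_]"] by (simp add: TdF_last w(1))
    also have "\<dots> = sw h (\<lambda>a b. sw x (\<lambda>p q. sy y (\<lambda>c y'. \<beta> (b # us @ p # q # ws @ [c * a], y'))))"
      by (rule bsum_cong, rule bsum_swap)
    also have "\<dots> = sw x (\<lambda>p q. sw h (\<lambda>a b. sy y (\<lambda>c y'. \<beta> (b # us @ p # q # ws @ [c * a], y'))))"
      by (rule bsum_swap)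
    also have "\<dots> = TdF n i (TdF (Suc n) (Suc j) \<beta>) (h # hs, y)"
      using 4 w(2) TdF_inner[of "h # us" i n _ x ws y] by (simp add: TdF_last w(1))
    finally show ?thesis .
  next
    case 5
    have "TdF n j (TdF (Suc n) i \<beta>) (h # hs, y) =
        sw h (\<lambda>a b. sy y (\<lambda>c y'. sw (c * a) (\<lambda>p q. \<beta> (b # hs @ [p, q], y'))))"
      using n TdF_inner[of "_ # hs" "Suc n" "Suc n" \<beta> _ "[]"] by (simp add: 5 TdF_last)
    also have "\<dots> = sw h (\<lambda>a b. sy y (\<lambda>c y'. sw c (\<lambda>c1 c2. sw a (\<lambda>a1 a2. \<beta> (b # hs @ [c1 * a1, c2 * a2], y')))))"
      by (rule bsum_cong, rule bsum_cong, rule sw_mult) (intro r)+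
    also have "\<dots> = sw h (\<lambda>a b. sy y (\<lambda>c y'. sy y' (\<lambda>d y''. sw a (\<lambda>a1 a2. \<beta> (b # hs @ [c * a1, d * a2], y'')))))"
      by (rule bsum_cong, rule sy_coassoc) (intro r)+
    also have "\<dots> = sw h (\<lambda>a b. sy y (\<lambda>c y'. sw a (\<lambda>a1 a2. sy y' (\<lambda>d y''. \<beta> (b # hs @ [c * a1, d * a2], y'')))))"
      by (rule bsum_cong, rule bsum_cong, rule bsum_swap)
    also have "\<dots> = sw h (\<lambda>a b. sw a (\<lambda>a1 a2. sy y (\<lambda>c y'. sy y' (\<lambda>d y''. \<beta> (b # hs @ [c * a1, d * a2], y'')))))"
      by (rule bsum_cong, rule bsum_swap)
    also have "\<dots> = sw h (\<lambda>a1 t. sw t (\<lambda>a2 b. sy y (\<lambda>c y'. sy y' (\<lambda>d y''. \<beta> (b # hs @ [c * a1, d * a2], y'')))))"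
      by (rule sw_coassoc) (intro r)+
    also have "\<dots> = sw h (\<lambda>a1 t. sy y (\<lambda>c y'. sw t (\<lambda>a2 b. sy y' (\<lambda>d y''. \<beta> (b # hs @ [c * a1, d * a2], y'')))))"
      by (rule bsum_cong, rule bsum_swap)
    also have "\<dots> = TdF n i (TdF (Suc n) (Suc j) \<beta>) (h # hs, y)"
      by (simp add: 5 TdF_last)
    finally show ?thesis .
  qed
qed

end

section \<open>Linear maps of tensors and their transposes\<close>

text \<open>
  Here \<open>g\<close> is the transpose of \<open>G\<close>. The form \<open>g \<beta>\<close> has to be multilinear on all words, since a
  tensor vanishes on every function that is not; two transposes that agree on \<open>V\<close> describe the same map.
\<close>

definition has_transpose ::
  "(('v \<Rightarrow> 'k::field) \<Rightarrow> bool) \<Rightarrow> 'v set \<Rightarrow> (('w \<Rightarrow> 'k) \<Rightarrow> bool) \<Rightarrow> 'w set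
    \<Rightarrow> (('k, 'v) tensor \<Rightarrow> ('k, 'w) tensor) \<Rightarrow> (('w \<Rightarrow> 'k) \<Rightarrow> 'v \<Rightarrow> 'k) \<Rightarrow> bool" where
  "has_transpose P V Q W G g \<longleftrightarrow>
     (\<forall>\<beta>. Q \<beta> \<longrightarrow> P (g \<beta>)) \<and>
     (\<forall>t\<in>tensors P V. G t \<in> tensors Q W \<and> (\<forall>\<beta>. Q \<beta> \<longrightarrow> G t \<beta> = t (g \<beta>)))"

lemma has_transposeD:
  assumes "has_transpose P V Q W G g"
  shows "Q \<beta> \<Longrightarrow> P (g \<beta>)" "t \<in> tensors P V \<Longrightarrow> G t \<in> tensors Q W"
    "t \<in> tensors P V \<Longrightarrow> Q \<beta> \<Longrightarrow> G t \<beta> = t (g \<beta>)"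
  using assms by (auto simp: has_transpose_def)

lemma has_transpose_comp:
  assumes "has_transpose P V Q W G g" "has_transpose Q W R X H h"
  shows "has_transpose P V R X (\<lambda>t. H (G t)) (\<lambda>\<beta>. g (h \<beta>))"
  using assms by (auto simp: has_transpose_def)

lemma has_transpose_id: "has_transpose P V P V (\<lambda>t. t) (\<lambda>\<beta>. \<beta>)"
  by (simp add: has_transpose_def)

lemma has_transpose_eq:
  assumes "has_transpose P V Q W G g" "has_transpose P V Q W G' g'" "t \<in> tensors P V"
    and "\<And>\<beta> w. Q \<beta> \<Longrightarrow> w \<in> V \<Longrightarrow> g \<beta> w = g' \<beta> w"
  shows "G t = G' t"
proof (rule tensor_ext)
  show "G t \<in> tensors Q W" "G' t \<in> tensors Q W" using assms has_transposeD(2) by blast+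
  fix \<beta> assume \<beta>: "Q \<beta>"
  have "t (g \<beta>) = t (g' \<beta>)"
    by (rule tensor_agree[OF assms(3)]) (use assms(4) \<beta> has_transposeD(1)[OF assms(1)] has_transposeD(1)[OF assms(2)] in auto)
  then show "G t \<beta> = G' t \<beta>"
    using has_transposeD(3)[OF assms(1,3) \<beta>] has_transposeD(3)[OF assms(2,3) \<beta>] by simp
qed

lemma has_transpose_cong:
  assumes G: "has_transpose P V Q W G g" and "\<And>t. t \<in> tensors P V \<Longrightarrow> G' t = G t"
    and g': "\<And>\<beta>. Q \<beta> \<Longrightarrow> P (g' \<beta>)" "\<And>\<beta> w. Q \<beta> \<Longrightarrow> w \<in> V \<Longrightarrow> g' \<beta> w = g \<beta> w"
  shows "has_transpose P V Q W G' g'"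
  unfolding has_transpose_def
proof (intro conjI allI impI ballI)
  fix t \<beta> assume t: "t \<in> tensors P V" and \<beta>: "Q \<beta>"
  have "t (g \<beta>) = t (g' \<beta>)"
    by (rule tensor_agree[OF t]) (use g' \<beta> has_transposeD(1)[OF G] in auto)
  then show "G' t \<beta> = t (g' \<beta>)" using assms(2)[OF t] has_transposeD(3)[OF G t \<beta>] by simp
qed (use assms has_transposeD(2)[OF G] in auto)

lemma subspace_tensors:
  fixes P :: "('w \<Rightarrow> 'k::field) \<Rightarrow> bool"
  shows "module.subspace fscale (tensors P W)"
proof -
  interpret vector_space "fscale :: 'k \<Rightarrow> ('k, 'w) tensor \<Rightarrow> _" by (rule vector_space_fscale)
  show ?thesis unfolding tensors_def by (rule subspace_span)
qed

lemma
  fixes P :: "('w \<Rightarrow> 'k::field) \<Rightarrow> bool"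
  shows tensors_add: "x \<in> tensors P W \<Longrightarrow> y \<in> tensors P W \<Longrightarrow> x + y \<in> tensors P W"
  and tensors_scale: "x \<in> tensors P W \<Longrightarrow> fscale c x \<in> tensors P W"
proof -
  interpret vector_space "fscale :: 'k \<Rightarrow> ('k, 'w) tensor \<Rightarrow> _" by (rule vector_space_fscale)
  show "x \<in> tensors P W \<Longrightarrow> y \<in> tensors P W \<Longrightarrow> x + y \<in> tensors P W"
    and "x \<in> tensors P W \<Longrightarrow> fscale c x \<in> tensors P W"
    using subspace_tensors[of P W] subspace_add subspace_scale by blast+
qed

lemma fscale_apply: "fscale c t \<beta> = c * t \<beta>"
  by (simp add: fscale_def)

lemma has_transpose_linear:
  assumes G: "has_transpose P V Q W G g"
  shows "linear_map_on fscale (tensors P V) fscale (tensors Q W) G"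
  unfolding linear_map_on_def
proof (intro conjI ballI allI funcsetI)
  note [simp] = has_transposeD(2,3)[OF G] tensors_add tensors_scale
  show "G x \<in> tensors Q W" if "x \<in> tensors P V" for x using that by simp
  show "G (x + y) = G x + G y" if "x \<in> tensors P V" "y \<in> tensors P V" for x y
    by (rule tensor_ext[of _ Q W _ W]) (use that in auto)
  show "G (fscale c x) = fscale c (G x)" if "x \<in> tensors P V" for c x
    by (rule tensor_ext[of _ Q W _ W]) (use that in \<open>auto simp: fscale_apply\<close>)
qed

text \<open>
  The hypothesis on \<open>f\<close> covers functions \<open>\<beta>\<close> that are not multilinear, where every tensor vanishes,
  because the multilinearity of \<open>f\<close> is tested at all \<open>\<beta>\<close>.
\<close>

lemma has_transpose_lin_ext:
  fixes f :: "'v \<Rightarrow> ('k::field, 'w) tensor"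
  assumes P: "pointwise_kind P TYPE('w)" "P (\<lambda>w. 0)"
    and g: "\<And>\<beta>. Q \<beta> \<Longrightarrow> P (g \<beta>)" "\<And>w \<beta>. f w \<beta> = (if Q \<beta> then g \<beta> w else 0)"
    and f: "\<And>w. w \<in> V \<Longrightarrow> f w \<in> tensors Q W"
  shows "has_transpose P V Q W (lin_ext P fscale f) g"
proof -
  have mult: "P (\<lambda>w. f w \<beta>)" for \<beta> using P(2) g by (cases "Q \<beta>") simp_all
  show ?thesis unfolding has_transpose_def
  proof (intro conjI allI impI ballI)
    fix t assume t: "t \<in> tensors P V"
    show "lin_ext P fscale f t \<in> tensors Q W"
      by (rule lin_ext_in_subspace[OF P(1) t mult f])
    fix \<beta> assume \<beta>: "Q \<beta>"
    have "lin_ext P fscale f t \<beta> = tsum P t (\<lambda>w. f w \<beta>)"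
      by (rule lin_ext_eval[OF P(1) t mult])
    then show "lin_ext P fscale f t \<beta> = t (g \<beta>)"
      using tsum_eval[OF t g(1)[OF \<beta>]] \<beta> by (simp add: g(2))
  qed (rule g)
qed

lemma lin_ext_ptens:
  fixes f :: "'v \<Rightarrow> ('k::field, 'w) tensor"
  assumes P: "pointwise_kind P TYPE('w)" "P (\<lambda>w. 0)"
    and g: "\<And>\<beta>. Q \<beta> \<Longrightarrow> P (g \<beta>)" "\<And>w \<beta>. f w \<beta> = (if Q \<beta> then g \<beta> w else 0)"
  shows "lin_ext P fscale f (ptens P w) = f w"
proof (rule tensors_universal(1)[OF vector_space_fscale])
  have "P (\<lambda>w. f w \<beta>)" for \<beta> using P(2) g by (cases "Q \<beta>") simp_all
  then show "\<And>\<phi>. lform fscale \<phi> \<Longrightarrow> P (\<lambda>w. \<phi> (f w))" using P(1) by (simp add: pointwise_kind_def)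
qed

lemma ext2_ptens:
  assumes t: "t \<in> tensors (bilin sA sB (*)) W'" and vs: "vector_space sA" "vector_space sB"
    and lin: "\<And>\<beta> b. Q \<beta> \<Longrightarrow> lform sA (\<lambda>a. \<beta> (p a b))" "\<And>\<beta> a. Q \<beta> \<Longrightarrow> lform sB (\<lambda>b. \<beta> (p a b))"
  shows "ext2 sA sB fscale (\<lambda>a b. ptens Q (p a b)) t \<beta> =
      (if Q \<beta> then bsum sA sB t (\<lambda>a b. \<beta> (p a b)) else 0)"
    and "(\<And>a b. p a b \<in> W) \<Longrightarrow> ext2 sA sB fscale (\<lambda>a b. ptens Q (p a b)) t \<in> tensors Q W"
proof -
  have lin': "lform sA (\<lambda>a. ptens Q (p a b) \<beta>)" "lform sB (\<lambda>b. ptens Q (p a b) \<beta>)" for a b \<beta>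
    unfolding ptens_def by (intro lform_ite vs lin; assumption)+
  show "ext2 sA sB fscale (\<lambda>a b. ptens Q (p a b)) t \<beta> =
      (if Q \<beta> then bsum sA sB t (\<lambda>a b. \<beta> (p a b)) else 0)"
    by (subst ext2_apply[OF t lin']) (simp add: ptens_def case_prod_unfold tsum_zero)
  show "ext2 sA sB fscale (\<lambda>a b. ptens Q (p a b)) t \<in> tensors Q W" if "\<And>a b. p a b \<in> W"
    by (rule lin_ext_in_subspace[OF pointwise_bilin[OF vs] t])
      (use lin' that in \<open>auto simp: bilin_def intro: ptens_in_tensors\<close>)
qed

lemma extL_ptens:
  assumes t: "t \<in> tensors (multilin s (*)) W'" and vs: "vector_space s"
    and p: "\<And>\<beta>. Q \<beta> \<Longrightarrow> mlform s (\<lambda>gs. \<beta> (p gs))"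
  shows "extL s fscale (\<lambda>gs. ptens Q (p gs)) t \<beta> = (if Q \<beta> then t (\<lambda>gs. \<beta> (p gs)) else 0)"
    and "(\<And>gs. gs \<in> W' \<Longrightarrow> p gs \<in> W) \<Longrightarrow> extL s fscale (\<lambda>gs. ptens Q (p gs)) t \<in> tensors Q W"
proof -
  have p': "mlform s (\<lambda>gs. ptens Q (p gs) \<beta>)" for \<beta>
    unfolding ptens_def by (rule mlformI) (use p[of \<beta>] vs in \<open>auto simp: multilin_def intro!: lform_ite\<close>)
  show "extL s fscale (\<lambda>gs. ptens Q (p gs)) t \<beta> = (if Q \<beta> then t (\<lambda>gs. \<beta> (p gs)) else 0)"
  proof -
    have "extL s fscale (\<lambda>gs. ptens Q (p gs)) t \<beta> = tsum (multilin s (*)) t (\<lambda>gs. ptens Q (p gs) \<beta>)"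
      by (rule lin_ext_eval[OF pointwise_multilin[OF vs] t]) (rule p')
    moreover have "tsum (multilin s (*)) t (\<lambda>gs. \<beta> (p gs)) = t (\<lambda>gs. \<beta> (p gs))" if "Q \<beta>"
      by (rule tsum_eval[OF t]) (rule p[OF that])
    ultimately show ?thesis by (simp add: tsum_ptens)
  qed
  show "extL s fscale (\<lambda>gs. ptens Q (p gs)) t \<in> tensors Q W" if "\<And>gs. gs \<in> W' \<Longrightarrow> p gs \<in> W"
    by (rule lin_ext_in_subspace[OF pointwise_multilin[OF vs] t]) (rule p', rule ptens_in_tensors, rule that)
qed

lemma mlform_zero: "vector_space s \<Longrightarrow> mlform s (\<lambda>gs. 0)"
  by (simp add: multilin_def lform_zero)

lemma lform_tensor_arg:
  assumes "t \<in> tensors P W" "\<And>x. P (F x)" "\<And>w. lform s (\<lambda>x. F x w)"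
  shows "lform s (\<lambda>x. t (F x))"
proof -
  have "tsum P t (F x) = t (F x)" for x by (rule tsum_eval[OF assms(1)]) (rule assms(2))
  moreover have "lform s (\<lambda>x. tsum P t (F x))" by (rule lform_tsum) (rule assms(3))
  ultimately show ?thesis by simp
qed

section \<open>The right action as a tensor\<close>

context hopf_algebra
begin

lemma extL_Cons:
  assumes t: "t \<in> tensors (multilin s (*)) W"
  shows "extL s fscale (\<lambda>bs. tensL s (a # bs)) t \<beta> = (if mlform s \<beta> then t (\<lambda>bs. \<beta> (a # bs)) else 0)"
    and "(\<And>bs. bs \<in> W \<Longrightarrow> a # bs \<in> W') \<Longrightarrow> extL s fscale (\<lambda>bs. tensL s (a # bs)) t \<in> tensors (multilin s (*)) W'"
  by (rule extL_ptens(1)[OF t vs], erule mlform_Cons) (rule extL_ptens(2)[OF t vs], erule mlform_Cons, blast)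

lemma lform_extL_Cons:
  assumes t: "\<And>b. t b \<in> tensors (multilin s (*)) W" and lt: "\<And>\<beta>. lform s (\<lambda>b. t b \<beta>)"
  shows "lform s (\<lambda>a. extL s fscale (\<lambda>bs. tensL s (a # bs)) (t b) \<beta>)"
    and "lform s (\<lambda>b. extL s fscale (\<lambda>bs. tensL s (a # bs)) (t b) \<beta>)"
  unfolding extL_Cons(1)[OF t]
  by (intro lform_ite vs lt lform_tensor_arg[OF t] mlform_Cons; (assumption | (erule lform_slot, intro slot_rules linear_self vs)))+

lemma iter_comult_closed_linear:
  "iter_comult s \<Delta> \<epsilon> n h \<in> tensors (multilin s (*)) {gs. length gs = n} \<and>
   lform s (\<lambda>h. iter_comult s \<Delta> \<epsilon> n h \<beta>)"
proof (induction n arbitrary: h \<beta> rule: induct_nat_012)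
  case 0
  show ?case
    by (intro conjI; simp only: iter_comult.simps)
      (simp_all add: tensors_scale ptens_in_tensors, simp add: fscale_def lform_mult_right counit_linear)
next
  case 1
  have "lform s (\<lambda>h. tensL s [h] \<beta>)"
    unfolding ptens_def by (intro lform_ite vs) (auto intro!: lform_slot slot_rules linear_self vs)
  then show ?case by (simp add: ptens_in_tensors)
next
  case (ge2 n)
  let ?t = "iter_comult s \<Delta> \<epsilon> (Suc n)"
  have t: "?t b \<in> tensors (multilin s (*)) {gs. length gs = Suc n}" and lt: "lform s (\<lambda>b. ?t b \<gamma>)" for b \<gamma>
    using ge2.IH(2) by blast+
  note lin = lform_extL_Cons[OF t lt]
  have "iter_comult s \<Delta> \<epsilon> (Suc (Suc n)) h \<in> tensors (multilin s (*)) {gs. length gs = Suc (Suc n)}"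
    unfolding iter_comult.simps
    by (rule lin_ext_in_subspace[OF pointwise_bilin[OF vs vs] comult_closed])
      (use lin extL_Cons(2)[OF t] in \<open>auto simp: bilin_def\<close>)
  moreover have "lform s (\<lambda>h. iter_comult s \<Delta> \<epsilon> (Suc (Suc n)) h \<beta>)"
    unfolding iter_comult.simps ext2_eval[OF lin] by (intro lform_sw lin linear_self vs)
  ultimately show ?case by blast
qed

lemmas iter_comult_closed = iter_comult_closed_linear[THEN conjunct1]
lemmas lform_iter_comult = iter_comult_closed_linear[THEN conjunct2]

lemma iter_comult_Suc:
  assumes "mlform s G"
  shows "iter_comult s \<Delta> \<epsilon> (Suc (Suc n)) h G = sw h (\<lambda>a b. iter_comult s \<Delta> \<epsilon> (Suc n) b (\<lambda>bs. G (a # bs)))"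
proof -
  note lin = lform_extL_Cons[OF iter_comult_closed lform_iter_comult]
  show ?thesis unfolding iter_comult.simps ext2_eval[OF lin] using assms by (simp add: extL_Cons(1)[OF iter_comult_closed])
qed

text \<open>
  The function of \<open>gs\<close> whose linear extension defines the action, paired with \<open>F\<close>.
\<close>

definition act_form :: "'h list \<Rightarrow> ('h list \<Rightarrow> 'k) \<Rightarrow> 'h list \<Rightarrow> 'k" where
  "act_form hs F = (\<lambda>gs. if length gs = length hs then F (map2 (*) hs gs) else 0)"

lemma mlform_act_form:
  assumes F: "mlform s F" shows "mlform s (act_form hs F)"
proof (rule mlformI)
  fix us ws :: "'h list"
  show "lform s (\<lambda>h. act_form hs F (us @ h # ws))"
  proof (cases "length (us @ 0 # ws) = length hs")
    case True
    then obtain ks k ls where hs: "hs = ks @ k # ls" "length ks = length us"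
      by (metis (mono_tags) append_eq_conv_conj id_take_nth_drop length_append length_greater_0_conv
          length_Cons less_add_same_cancel1 length_take min.absorb4 zero_less_Suc)
    with True show ?thesis
      by (simp add: act_form_def) (intro lform_slot[OF F] slot_rules linear_times_right linear_self vs)
  next
    case False
    then show ?thesis by (simp add: act_form_def lform_zero vs)
  qed
qed

lemma iter_comult_act_form:
  "mlform s F \<Longrightarrow> iter_comult s \<Delta> \<epsilon> (length hs) h (act_form hs F) = diag hs h F"
proof (induction hs arbitrary: h F rule: induct_list012)
  case 1
  then show ?case using mlform_act_form[OF 1, of "[]"] by (simp add: fscale_def ptens_def act_form_def)
next
  case (2 x)
  have "lform s (\<lambda>x. F [x])" by (intro lform_slot[OF 2] slot_rules linear_self vs)
  then show ?case
    using mlform_act_form[OF 2, of "[x]"] diag_single[of F x h] by (simp add: ptens_def act_form_def)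
next
  case (3 x y zs)
  have *: "(\<lambda>bs. act_form (x # y # zs) F (a # bs)) = act_form (y # zs) (\<lambda>gs. F ((x * a) # gs))" for a
    by (auto simp: act_form_def fun_eq_iff)
  have "iter_comult s \<Delta> \<epsilon> (length (x # y # zs)) h (act_form (x # y # zs) F) =
      sw h (\<lambda>a b. iter_comult s \<Delta> \<epsilon> (length (y # zs)) b (act_form (y # zs) (\<lambda>gs. F ((x * a) # gs))))"
    using iter_comult_Suc[OF mlform_act_form[OF 3(3), of "x # y # zs"], of "length zs" h] by (simp add: *)
  also have "\<dots> = sw h (\<lambda>a b. diag (y # zs) b (\<lambda>gs. F ((x * a) # gs)))"
    by (intro bsum_cong 3(2) mlform_Cons 3(3))
  finally show ?case by simp
qed

lemma
  shows ract_closed: "ract s \<Delta> \<epsilon> hs h \<in> tensors (multilin s (*)) {gs. length gs = length hs}"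
    and ract_eval: "ract s \<Delta> \<epsilon> hs h F = (if mlform s F then diag hs h F else 0)"
proof -
  let ?f = "\<lambda>gs. if length gs = length hs then tensL s (map2 (*) hs gs) else 0"
  have f: "?f gs F = (if mlform s F then act_form hs F gs else 0)" for gs F
    by (simp add: act_form_def ptens_def)
  have ml: "mlform s (\<lambda>gs. ?f gs F)" for F
    unfolding f by (cases "mlform s F") (simp_all add: mlform_act_form mlform_zero vs)
  show "ract s \<Delta> \<epsilon> hs h \<in> tensors (multilin s (*)) {gs. length gs = length hs}"
    unfolding ract_def
    by (rule lin_ext_in_subspace[OF pointwise_multilin[OF vs] iter_comult_closed], rule ml)
      (auto intro: ptens_in_tensors)
  show "ract s \<Delta> \<epsilon> hs h F = (if mlform s F then diag hs h F else 0)"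
    unfolding ract_def
  proof -
    have "extL s fscale ?f (iter_comult s \<Delta> \<epsilon> (length hs) h) F =
        tsum (multilin s (*)) (iter_comult s \<Delta> \<epsilon> (length hs) h) (\<lambda>gs. ?f gs F)"
      by (rule lin_ext_eval[OF pointwise_multilin[OF vs] iter_comult_closed]) (rule ml)
    then show "extL s fscale ?f (iter_comult s \<Delta> \<epsilon> (length hs) h) F = (if mlform s F then diag hs h F else 0)"
      unfolding f
      by (cases "mlform s F")
        (simp_all add: tsum_zero tsum_eval[OF iter_comult_closed, OF mlform_act_form] iter_comult_act_form)
  qed
qed

text \<open>
  The common form of \<open>\<Phi>\<close> and \<open>\<Psi>\<close> on an elementary tensor: a component of \<open>h\<close> acts on the middle factors
  through \<open>g\<close>, which is the antipode for \<open>\<Phi>\<close> and the identity for \<open>\<Psi>\<close>, and \<open>p\<close> reassembles the result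
  into a word.
\<close>

lemma ext2_ract:
  assumes p: "\<And>\<beta> b. Q \<beta> \<Longrightarrow> mlform s (\<lambda>gs. \<beta> (p b gs))"
      "\<And>\<beta> gs. Q \<beta> \<Longrightarrow> lform s (\<lambda>b. \<beta> (p b gs))"
    and g: "Vector_Spaces.linear s s g"
  shows "ext2 s s fscale
        (\<lambda>a b. extL s fscale (\<lambda>gs. ptens Q (p b gs)) (ract s \<Delta> \<epsilon> hs (g a))) (\<Delta> h) \<beta> =
      (if Q \<beta> then sw h (\<lambda>a b. diag hs (g a) (\<lambda>gs. \<beta> (p b gs))) else 0)" (is "?T \<beta> = ?R")
    and "(\<And>b gs. length gs = length hs \<Longrightarrow> p b gs \<in> W) \<Longrightarrow>
      ext2 s s fscale
        (\<lambda>a b. extL s fscale (\<lambda>gs. ptens Q (p b gs)) (ract s \<Delta> \<epsilon> hs (g a))) (\<Delta> h) \<in> tensors Q W"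
proof -
  have e2: "extL s fscale (\<lambda>gs. ptens Q (p b gs)) (ract s \<Delta> \<epsilon> hs k) \<in> tensors Q W"
    if "\<And>gs. length gs = length hs \<Longrightarrow> p b gs \<in> W" for b k W
    by (rule extL_ptens(2)[OF ract_closed vs]) (use p that in auto)
  have e1: "extL s fscale (\<lambda>gs. ptens Q (p b gs)) (ract s \<Delta> \<epsilon> hs k) \<beta> =
      (if Q \<beta> then diag hs k (\<lambda>gs. \<beta> (p b gs)) else 0)" for b k \<beta>
    by (subst extL_ptens(1)[OF ract_closed vs]) (simp_all add: ract_eval p(1))
  have lin: "lform s (\<lambda>a. extL s fscale (\<lambda>gs. ptens Q (p b gs)) (ract s \<Delta> \<epsilon> hs (g a)) \<beta>)"
    "lform s (\<lambda>b. extL s fscale (\<lambda>gs. ptens Q (p b gs)) (ract s \<Delta> \<epsilon> hs (g a)) \<beta>)" for a b \<beta>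
    unfolding e1 by (intro lform_ite vs lform_diag p g lform_diag_arg; assumption)+
  show "?T \<beta> = ?R"
    unfolding ext2_eval[OF lin] by (simp add: e1 case_prod_unfold tsum_zero)
  show "?T \<in> tensors Q W" if "\<And>b gs. length gs = length hs \<Longrightarrow> p b gs \<in> W"
    by (rule lin_ext_in_subspace[OF pointwise_bilin[OF vs vs] comult_closed])
      (use lin that e2 in \<open>auto simp: bilin_def\<close>)
qed

lemma
  shows coad_closed: "coad s \<Delta> S h \<in> tensors (bilin s s (*)) UNIV"
    and bsum_coad: "(\<And>b. lform s (\<lambda>a. F a b)) \<Longrightarrow> (\<And>a. lform s (\<lambda>b. F a b)) \<Longrightarrow>
      bsum s s (coad s \<Delta> S h) F = sw h (\<lambda>a r. sw r (\<lambda>b c. F b (c * S a)))"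
proof -
  have b: "lform s (\<lambda>a. \<beta> (g a, b))" "lform s (\<lambda>a. \<beta> (b, g a))"
    if "bilin s s (*) \<beta>" "Vector_Spaces.linear s s g" for \<beta> b g
    using that lform_app[of "\<lambda>a. \<beta> (a, b)" s g] lform_app[of "\<lambda>a. \<beta> (b, a)" s g] by (auto simp: bilin_def)
  have e: "ext2 s s fscale (\<lambda>h2 h3. tens2 s s h2 (h3 * S h1)) (\<Delta> h') \<beta> =
      (if bilin s s (*) \<beta> then sw h' (\<lambda>h2 h3. \<beta> (h2, h3 * S h1)) else 0)" for h1 h' \<beta>
    by (rule ext2_ptens(1)[OF comult_closed vs vs]) (intro b lin_rules; assumption)+
  have c: "ext2 s s fscale (\<lambda>h2 h3. tens2 s s h2 (h3 * S h1)) (\<Delta> h') \<in> tensors (bilin s s (*)) UNIV" for h1 h'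
    by (rule ext2_ptens(2)[OF comult_closed vs vs]) (intro b lin_rules UNIV_I; assumption)+
  have lin: "lform s (\<lambda>h1. ext2 s s fscale (\<lambda>h2 h3. tens2 s s h2 (h3 * S h1)) (\<Delta> h') \<beta>)"
    "lform s (\<lambda>h'. ext2 s s fscale (\<lambda>h2 h3. tens2 s s h2 (h3 * S h1)) (\<Delta> h') \<beta>)" for h1 h' \<beta>
    unfolding e by (intro lform_ite vs b lin_rules; assumption)+
  show closed: "coad s \<Delta> S h \<in> tensors (bilin s s (*)) UNIV"
    unfolding coad_def
    by (rule lin_ext_in_subspace[OF pointwise_bilin[OF vs vs] comult_closed])
      (use lin c in \<open>auto simp: bilin_def\<close>)
  have val: "coad s \<Delta> S h \<beta> = sw h (\<lambda>a r. ext2 s s fscale (\<lambda>h2 h3. tens2 s s h2 (h3 * S a)) (\<Delta> r) \<beta>)" for h \<beta>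
    unfolding coad_def by (rule ext2_eval[OF lin])
  show "bsum s s (coad s \<Delta> S h) F = sw h (\<lambda>a r. sw r (\<lambda>b c. F b (c * S a)))"
    if "\<And>b. lform s (\<lambda>a. F a b)" "\<And>a. lform s (\<lambda>b. F a b)"
    using bilinI[of s F s, OF that] by (simp add: bsum_eval[OF closed that] val e)
qed

end

context hopf_comodule
begin

section \<open>The cofaces and the isomorphism\<close>

abbreviation "Twords n \<equiv> {(hs :: 'h list, y :: 'y). length hs = n + 1}"
abbreviation "Bwords n \<equiv> {(x :: 'h, cs :: 'h list, y :: 'y). length cs = n}"

lemma Tform_zero: "Tform (\<lambda>w. 0)"
  by (simp add: multilinT_def lform_zero vs vsY)

lemma Bform_zero: "Bform (\<lambda>w. 0)"
  by (simp add: multilinB_def lform_zero vs vsY)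

lemmas has_transpose_extT = has_transpose_lin_ext[OF pointwise_multilinT[OF vs vsY] Tform_zero]
lemmas has_transpose_extB = has_transpose_lin_ext[OF pointwise_multilinB[OF vs vs vsY] Bform_zero]

text \<open>
  The coface 0 is defined through \<open>hd\<close>, the explicit cofaces through indexing; these may differ at the
  empty list, so the transpose read off from the definition is replaced by one that agrees with it on
  the spanning words.
\<close>

lemma transpose_T_coface0: "has_transpose Tform (Twords n) Tform (Twords (n + 1)) (T_coface0 s sY \<Delta>) (TdF n 0)"
proof -
  let ?g = "\<lambda>\<beta> (hs, y). sw (hd hs) (\<lambda>a b. \<beta> (a # b # tl hs, y))"
  have g: "Tform (?g \<beta>)" if \<beta>: "Tform \<beta>" for \<beta>
  proof (rule TformI)
    note r = Tform_slot[OF \<beta>] Tform_module[OF \<beta>] form_rules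
    show "lform sY (\<lambda>y. ?g \<beta> (hs, y))" for hs
      unfolding prod.case by (intro r)
    show "lform s (\<lambda>h. ?g \<beta> (us @ h # ws, y))" for us ws y
      unfolding prod.case by (cases us) (simp; intro r)+
  qed
  have e: "ext2 s s fscale (\<lambda>a b. tensT s sY (a # b # tl hs) y) (\<Delta> (hd hs)) \<beta> =
      (if Tform \<beta> then sw (hd hs) (\<lambda>a b. \<beta> (a # b # tl hs, y)) else 0)" for hs y \<beta>
    by (rule ext2_ptens(1)[OF comult_closed vs vs]) (intro Tform_slot form_rules; assumption)+
  have c: "ext2 s s fscale (\<lambda>a b. tensT s sY (a # b # tl hs) y) (\<Delta> (hd hs)) \<in> tensors Tform (Twords (n + 1))"
    if "length hs = n + 1" for hs y
    by (rule ext2_ptens(2)[OF comult_closed vs vs])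
      ((intro Tform_slot form_rules; assumption)+, use that in auto)
  have "has_transpose Tform (Twords n) Tform (Twords (n + 1)) (T_coface0 s sY \<Delta>) ?g"
    unfolding T_coface0_def by (rule has_transpose_extT) (use g e c in auto)
  then show ?thesis
  proof (rule has_transpose_cong)
    fix \<beta> and w :: "'h list \<times> 'y" assume "w \<in> Twords n"
    then obtain h hs y where "w = (h # hs, y)" by (cases w; cases "fst w") auto
    then show "TdF n 0 \<beta> w = ?g \<beta> w" by (simp add: TdF_def comult_at_0)
  qed (auto intro: Tform_TdF)
qed

lemma transpose_T_tau: "has_transpose Tform (Twords n) Tform (Twords n) (T_tau s sY S \<rho>) tauF"
proof -
  have e: "ext2 s sY fscale (\<lambda>a y'. tensT s sY ((Sinv a * last hs) # butlast hs) y') (\<rho> y) \<beta> =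
      (if Tform \<beta> then sy y (\<lambda>a y'. \<beta> ((Sinv a * last hs) # butlast hs, y')) else 0)" for hs y \<beta>
    by (rule ext2_ptens(1)[OF coact_closed vs vsY]) (intro Tform_slot Tform_module form_rules; assumption)+
  have c: "ext2 s sY fscale (\<lambda>a y'. tensT s sY ((Sinv a * last hs) # butlast hs) y') (\<rho> y) \<in> tensors Tform (Twords n)"
    if "length hs = n + 1" for hs y
    by (rule ext2_ptens(2)[OF coact_closed vs vsY])
      ((intro Tform_slot Tform_module form_rules; assumption)+, use that in auto)
  show ?thesis
    unfolding T_tau_def by (rule has_transpose_extT) (use e c Tform_tauF in \<open>auto simp: tauF_def\<close>)
qed

definition T_rot where
  "T_rot = extT s sY fscale
     (\<lambda>hs y. ext2 s sY fscale (\<lambda>a y'. tensT s sY (tl hs @ [a * hd hs]) y') (\<rho> y))"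

lemma transpose_T_rot: "has_transpose Tform (Twords n) Tform (Twords n) T_rot rotF"
proof -
  have e: "ext2 s sY fscale (\<lambda>a y'. tensT s sY (tl hs @ [a * hd hs]) y') (\<rho> y) \<beta> =
      (if Tform \<beta> then sy y (\<lambda>a y'. \<beta> (tl hs @ [a * hd hs], y')) else 0)" for hs y \<beta>
    by (rule ext2_ptens(1)[OF coact_closed vs vsY]) (intro Tform_slot Tform_module form_rules; assumption)+
  have c: "ext2 s sY fscale (\<lambda>a y'. tensT s sY (tl hs @ [a * hd hs]) y') (\<rho> y) \<in> tensors Tform (Twords n)"
    if "length hs = n + 1" for hs y
    by (rule ext2_ptens(2)[OF coact_closed vs vsY])
      ((intro Tform_slot Tform_module form_rules; assumption)+, use that in auto)
  show ?thesis
    unfolding T_rot_def by (rule has_transpose_extT) (use e c Tform_rotF in \<open>auto simp: rotF_def\<close>)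
qed

lemma Twords_Cons: "w \<in> Twords n \<Longrightarrow> (\<And>h hs y. w = (h # hs, y) \<Longrightarrow> length hs = n \<Longrightarrow> P) \<Longrightarrow> P"
  by (cases w; cases "fst w") auto

lemma Twords_snoc: "w \<in> Twords n \<Longrightarrow> (\<And>h hs y. w = (hs @ [h], y) \<Longrightarrow> length hs = n \<Longrightarrow> P) \<Longrightarrow> P"
  by (cases w; cases "fst w" rule: rev_cases) auto

lemma T_tau_rot: "t \<in> T_space s sY n \<Longrightarrow> T_tau s sY S \<rho> (T_rot t) = t"
  unfolding T_space_def
  by (rule has_transpose_eq[OF has_transpose_comp[OF transpose_T_rot transpose_T_tau] has_transpose_id])
    (assumption, erule Twords_Cons, simp add: rotF_tauF)

lemma T_rot_tau: "t \<in> T_space s sY n \<Longrightarrow> T_rot (T_tau s sY S \<rho> t) = t"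
  unfolding T_space_def
  by (rule has_transpose_eq[OF has_transpose_comp[OF transpose_T_tau transpose_T_rot] has_transpose_id])
    (assumption, erule Twords_snoc, simp add: tauF_rotF)

lemma inv_T_tau:
  assumes "t \<in> T_space s sY n"
  shows "inv_into (T_space s sY n) (T_tau s sY S \<rho>) t = T_rot t"
proof (rule inv_into_f_eq)
  show "inj_on (T_tau s sY S \<rho>) (T_space s sY n)"
    by (rule inj_on_inverseI, rule T_rot_tau)
  show "T_rot t \<in> T_space s sY n"
    using assms has_transposeD(2)[OF transpose_T_rot] by (simp add: T_space_def)
qed (rule T_tau_rot[OF assms])

text \<open>
  The explicit formula for the cofaces, by induction on \<open>j\<close> from \<open>\<partial>\<^sub>j\<^sub>+\<^sub>1 = \<tau> \<partial>\<^sub>j \<tau>\<^sup>-\<^sup>1\<close>: moving \<open>\<tau>\<close> past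
  \<open>\<partial>\<^sub>j\<close> leaves \<open>\<partial>\<^sub>j\<^sub>+\<^sub>1 \<tau> \<tau>\<^sup>-\<^sup>1\<close>.
\<close>

lemma transpose_T_coface:
  "j \<le> Suc n \<Longrightarrow> has_transpose Tform (Twords n) Tform (Twords (n + 1)) (T_coface s sY \<Delta> S \<rho> n j) (TdF n j)"
proof (induction j)
  case 0
  then show ?case using transpose_T_coface0 by (simp add: T_coface_def)
next
  case (Suc j)
  then have IH: "has_transpose Tform (Twords n) Tform (Twords (n + 1)) (T_coface s sY \<Delta> S \<rho> n j) (TdF n j)" by simp
  have step: "T_coface s sY \<Delta> S \<rho> n (Suc j) t = T_tau s sY S \<rho> (T_coface s sY \<Delta> S \<rho> n j (T_rot t))"
    if "t \<in> T_space s sY n" for t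
    using inv_T_tau[OF that] by (simp add: T_coface_def funpow_swap1)
  show ?case
  proof (rule has_transpose_cong[OF has_transpose_comp[OF has_transpose_comp[OF transpose_T_rot IH] transpose_T_tau]])
    fix t assume "t \<in> tensors Tform (Twords n)"
    then show "T_coface s sY \<Delta> S \<rho> n (Suc j) t = T_tau s sY S \<rho> (T_coface s sY \<Delta> S \<rho> n j (T_rot t))"
      using step by (simp add: T_space_def)
  next
    fix \<beta> and w :: "'h list \<times> 'y" assume \<beta>: "Tform \<beta>" and w_in: "w \<in> Twords n"
    from w_in obtain h hs y where w: "w = (h # hs, y)" "length hs = n" by (rule Twords_Cons)
    have eq: "TdF n j (tauF \<beta>) (hs @ [z], y') = tauF (TdF n (Suc j) \<beta>) (hs @ [z], y')" for z y'
      using TdF_tauF[OF \<beta> w(2)] Suc.prems by simp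
    have "rotF (TdF n j (tauF \<beta>)) w = rotF (tauF (TdF n (Suc j) \<beta>)) w"
      by (simp add: w rotF_def eq)
    also have "\<dots> = TdF n (Suc j) \<beta> w"
      unfolding w by (rule rotF_tauF[OF Tform_TdF[OF \<beta>]])
    finally show "TdF n (Suc j) \<beta> w = rotF (TdF n j (tauF \<beta>)) w" by simp
  qed (rule Tform_TdF)
qed

lemma transpose_B_coface:
  "has_transpose Bform (Bwords n) Bform (Bwords (n + 1)) (B_coface s s sY \<Delta> (coad s \<Delta> S) \<rho> n j) (BdF n j)"
proof -
  let ?D0 = "\<lambda>x cs y. ext2 s s fscale (\<lambda>x' c. tensB s s sY x' (c # cs) y) (coad s \<Delta> S x)"
  let ?D1 = "\<lambda>x cs y. ext2 s s fscale
              (\<lambda>a b. tensB s s sY x (take (j - 1) cs @ a # b # drop j cs) y) (\<Delta> (cs ! (j - 1)))"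
  let ?D2 = "\<lambda>x cs y. ext2 s sY fscale (\<lambda>c y'. tensB s s sY x (cs @ [c]) y') (\<rho> y)"
  have e0: "?D0 x cs y \<beta> = (if Bform \<beta> then sw x (\<lambda>a r. sw r (\<lambda>b c. \<beta> (b, (c * S a) # cs, y))) else 0)" for x cs y \<beta>
  proof (subst ext2_ptens(1)[OF coad_closed vs vs])
    show "(if Bform \<beta> then bsum s s (coad s \<Delta> S x) (\<lambda>a b. \<beta> (a, b # cs, y)) else 0) =
      (if Bform \<beta> then sw x (\<lambda>a r. sw r (\<lambda>b c. \<beta> (b, (c * S a) # cs, y))) else 0)"
      by (simp, intro impI bsum_coad Bform_head Bform_slot form_rules)
  qed (intro Bform_head Bform_slot form_rules; assumption)+
  have c0: "?D0 x cs y \<in> tensors Bform (Bwords (n + 1))" if "length cs = n" for x cs y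
    by (rule ext2_ptens(2)[OF coad_closed vs vs])
      ((intro Bform_head Bform_slot form_rules; assumption)+, use that in auto)
  have e1: "?D1 x cs y \<beta> = (if Bform \<beta> then sw (cs ! (j - 1)) (\<lambda>a b. \<beta> (x, take (j - 1) cs @ a # b # drop j cs, y)) else 0)" for x cs y \<beta>
    by (rule ext2_ptens(1)[OF comult_closed vs vs]) (intro Bform_slot form_rules; assumption)+
  have c1: "?D1 x cs y \<in> tensors Bform (Bwords (n + 1))" if "length cs = n" "j \<noteq> 0" "j \<le> n" for x cs y
    by (rule ext2_ptens(2)[OF comult_closed vs vs])
      ((intro Bform_slot form_rules; assumption)+, use that in auto)
  have e2: "?D2 x cs y \<beta> = (if Bform \<beta> then sy y (\<lambda>c y'. \<beta> (x, cs @ [c], y')) else 0)" for x cs y \<beta>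
    by (rule ext2_ptens(1)[OF coact_closed vs vsY]) (intro Bform_module Bform_slot form_rules; assumption)+
  have c2: "?D2 x cs y \<in> tensors Bform (Bwords (n + 1))" if "length cs = n" for x cs y
    by (rule ext2_ptens(2)[OF coact_closed vs vsY])
      ((intro Bform_module Bform_slot form_rules; assumption)+, use that in auto)
  show ?thesis
    unfolding B_coface_def
  proof (rule has_transpose_extB)
    fix w \<beta>
    show "(case w of (x, cs, y) \<Rightarrow> if j = 0 then ?D0 x cs y else if j \<le> n then ?D1 x cs y else ?D2 x cs y) \<beta> =
      (if Bform \<beta> then BdF n j \<beta> w else 0)"
      by (cases w) (auto simp: e0 e1 e2 BdF_def comult_at_def simp del: One_nat_def)
  next
    fix w :: "'h \<times> 'h list \<times> 'y" assume "w \<in> Bwords n"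
    then show "(case w of (x, cs, y) \<Rightarrow> if j = 0 then ?D0 x cs y else if j \<le> n then ?D1 x cs y else ?D2 x cs y)
      \<in> tensors Bform (Bwords (n + 1))"
      using c0 c1 c2 by (cases w) (auto simp del: One_nat_def)
  qed (rule Bform_BdF)
qed

text \<open>
  One map serves all degrees \<open>n\<close>, as the length of a word is not fixed in advance.
\<close>

definition Phi_word where
  "Phi_word = (\<lambda>(hs, y). ext2 s s fscale
     (\<lambda>a b. extL s fscale (\<lambda>gs. tensB s s sY b gs y) (ract s \<Delta> \<epsilon> (tl hs) (S a))) (\<Delta> (hd hs)))"

definition "Phi = lin_ext Tform fscale Phi_word"

definition Psi_word where
  "Psi_word = (\<lambda>(x, cs, y). ext2 s s fscale
     (\<lambda>a b. extL s fscale (\<lambda>gs. tensT s sY (b # gs) y) (ract s \<Delta> \<epsilon> cs a)) (\<Delta> x))"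

definition "Psi = lin_ext Bform fscale Psi_word"

lemma Phi_word_eval: "Phi_word w \<beta> = (if Bform \<beta> then PhiF \<beta> w else 0)"
proof (cases w)
  case (Pair hs y)
  show ?thesis
    unfolding Phi_word_def PhiF_def Pair prod.case
    by (rule ext2_ract(1)[where p = "\<lambda>b gs. (b, gs, y)" and g = S])
      (intro Bform_mlform Bform_head linear_self vs antipode_linear; assumption)+
qed

lemma transpose_Phi: "has_transpose Tform (Twords n) Bform (Bwords n) Phi PhiF"
proof -
  have "Phi_word (hs, y) \<in> tensors Bform (Bwords n)" if "length hs = n + 1" for hs y
    unfolding Phi_word_def prod.case
    by (rule ext2_ract(2)[where p = "\<lambda>b gs. (b, gs, y)" and g = S])
      ((intro Bform_mlform Bform_head linear_self vs antipode_linear; assumption)+, use that in auto)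
  then show ?thesis
    unfolding Phi_def by (intro has_transpose_extT) (auto simp: Phi_word_eval Tform_PhiF)
qed

lemma Psi_word_eval: "Psi_word w \<beta> = (if Tform \<beta> then PsiF \<beta> w else 0)"
proof (cases w rule: prod_cases3)
  case (fields x cs y)
  show ?thesis
    unfolding Psi_word_def PsiF_def fields prod.case
    by (rule ext2_ract(1)[where p = "\<lambda>b gs. (b # gs, y)" and g = "\<lambda>x. x"])
      (intro mlform_Cons Tform_mlform Tform_slot slot_rules linear_self vs; assumption)+
qed

lemma transpose_Psi: "has_transpose Bform (Bwords n) Tform (Twords n) Psi PsiF"
proof -
  have "Psi_word (x, cs, y) \<in> tensors Tform (Twords n)" if "length cs = n" for x cs y
    unfolding Psi_word_def prod.case
    by (rule ext2_ract(2)[where p = "\<lambda>b gs. (b # gs, y)" and g = "\<lambda>x. x"])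
      ((intro mlform_Cons Tform_mlform Tform_slot slot_rules linear_self vs; assumption)+, use that in auto)
  then show ?thesis
    unfolding Psi_def by (intro has_transpose_extB) (auto simp: Psi_word_eval Bform_PsiF)
qed

lemma Psi_Phi: "t \<in> T_space s sY n \<Longrightarrow> Psi (Phi t) = t"
  unfolding T_space_def
  by (rule has_transpose_eq[OF has_transpose_comp[OF transpose_Phi transpose_Psi] has_transpose_id])
    (assumption, erule Twords_Cons, simp add: PhiF_PsiF)

lemma Phi_Psi: "t \<in> B_space s s sY n \<Longrightarrow> Phi (Psi t) = t"
  unfolding B_space_def
  by (rule has_transpose_eq[OF has_transpose_comp[OF transpose_Psi transpose_Phi] has_transpose_id]) (auto simp: PsiF_PhiF)

abbreviation "T_d \<equiv> T_coface s sY \<Delta> S \<rho>"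
abbreviation "B_d \<equiv> B_coface s s sY \<Delta> (coad s \<Delta> S) \<rho>"

lemma Phi_closed: "t \<in> T_space s sY n \<Longrightarrow> Phi t \<in> B_space s s sY n"
  and Psi_closed: "u \<in> B_space s s sY n \<Longrightarrow> Psi u \<in> T_space s sY n"
  and T_d_closed: "j \<le> n + 1 \<Longrightarrow> t \<in> T_space s sY n \<Longrightarrow> T_d n j t \<in> T_space s sY (n + 1)"
  using has_transposeD(2)[OF transpose_Phi] has_transposeD(2)[OF transpose_Psi] has_transposeD(2)[OF transpose_T_coface]
  by (auto simp: T_space_def B_space_def)

lemma Phi_coface:
  assumes "j \<le> n + 1" "t \<in> T_space s sY n"
  shows "Phi (T_d n j t) = B_d n j (Phi t)"
proof -
  have L: "has_transpose Tform (Twords n) Bform (Bwords (n + 1)) (\<lambda>t. Phi (T_d n j t)) (\<lambda>\<beta>. TdF n j (PhiF \<beta>))"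
    by (rule has_transpose_comp[OF transpose_T_coface transpose_Phi]) (use assms in simp)
  have R: "has_transpose Tform (Twords n) Bform (Bwords (n + 1)) (\<lambda>t. B_d n j (Phi t)) (\<lambda>\<beta>. PhiF (BdF n j \<beta>))"
    by (rule has_transpose_comp[OF transpose_Phi transpose_B_coface])
  have t: "t \<in> tensors Tform (Twords n)" using assms by (simp add: T_space_def)
  show ?thesis
    by (rule has_transpose_eq[OF L R t]) (erule Twords_Cons, simp add: TdF_PhiF)
qed

lemma T_cosimplicial: "cosimplicial_module fscale (T_space s sY) T_d"
  unfolding cosimplicial_module_def
proof (intro conjI allI impI ballI)
  show "vector_space (fscale :: 'k \<Rightarrow> ('k, 'h list \<times> 'y) tensor \<Rightarrow> _)" by (rule vector_space_fscale)
  show "module.subspace fscale (T_space s sY n)" for n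
    unfolding T_space_def by (rule subspace_tensors)
  show "linear_map_on fscale (T_space s sY n) fscale (T_space s sY (n + 1)) (T_d n i)" if "i \<le> n + 1" for n i
    unfolding T_space_def by (rule has_transpose_linear[OF transpose_T_coface]) (use that in simp)
  show "T_d (n + 1) i (T_d n j t) = T_d (n + 1) (j + 1) (T_d n i t)"
    if "j \<le> n + 1" "i \<le> j" "t \<in> T_space s sY n" for n i j t
  proof -
    have L: "has_transpose Tform (Twords n) Tform (Twords (n + 1 + 1)) (\<lambda>t. T_d (n + 1) i (T_d n j t))
        (\<lambda>\<beta>. TdF n j (TdF (n + 1) i \<beta>))"
      by (rule has_transpose_comp[OF transpose_T_coface transpose_T_coface]) (use that in simp_all)
    have R: "has_transpose Tform (Twords n) Tform (Twords (n + 1 + 1)) (\<lambda>t. T_d (n + 1) (j + 1) (T_d n i t))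
        (\<lambda>\<beta>. TdF n i (TdF (n + 1) (j + 1) \<beta>))"
      by (rule has_transpose_comp[OF transpose_T_coface transpose_T_coface]) (use that in simp_all)
    have t: "t \<in> tensors Tform (Twords n)" using that by (simp add: T_space_def)
    show ?thesis
      by (rule has_transpose_eq[OF L R t]) (erule Twords_Cons, use that in \<open>simp add: TdF_cosimplicial\<close>)
  qed
qed

text \<open>
  The identities are transported from \<open>T\<^sub>*(H, Y)\<close>: every element of the cobar complex is \<open>\<Phi> t\<close> for some
  \<open>t\<close>, and \<open>\<Phi>\<close> commutes with the cofaces.
\<close>

lemma B_cosimplicial: "cosimplicial_module fscale (B_space s s sY) B_d"
  unfolding cosimplicial_module_def
proof (intro conjI allI impI ballI)
  show "vector_space (fscale :: 'k \<Rightarrow> ('k, 'h \<times> 'h list \<times> 'y) tensor \<Rightarrow> _)" by (rule vector_space_fscale)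
  show "module.subspace fscale (B_space s s sY n)" for n
    unfolding B_space_def by (rule subspace_tensors)
  show "linear_map_on fscale (B_space s s sY n) fscale (B_space s s sY (n + 1)) (B_d n i)" if "i \<le> n + 1" for n i
    unfolding B_space_def by (rule has_transpose_linear[OF transpose_B_coface])
  show "B_d (n + 1) i (B_d n j u) = B_d (n + 1) (j + 1) (B_d n i u)"
    if ij: "j \<le> n + 1" "i \<le> j" and u: "u \<in> B_space s s sY n" for n i j u
  proof -
    define t where "t = Psi u"
    have t: "t \<in> T_space s sY n" and u_eq: "u = Phi t"
      using Psi_closed[OF u] Phi_Psi[OF u] by (simp_all add: t_def)
    have "B_d (n + 1) i (B_d n j u) = Phi (T_d (n + 1) i (T_d n j t))"
      using ij t T_d_closed[of j n t] Phi_coface[of j n t] Phi_coface[of i "n + 1" "T_d n j t"] by (simp add: u_eq)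
    also have "\<dots> = Phi (T_d (n + 1) (j + 1) (T_d n i t))"
      using T_cosimplicial ij t unfolding cosimplicial_module_def by simp
    also have "\<dots> = B_d (n + 1) (j + 1) (B_d n i u)"
      using ij t T_d_closed[of i n t] Phi_coface[of i n t] Phi_coface[of "j + 1" "n + 1" "T_d n i t"] by (simp add: u_eq)
    finally show ?thesis .
  qed
qed

lemma Phi_cosimplicial_iso: "cosimplicial_iso fscale (T_space s sY) T_d fscale (B_space s s sY) B_d (\<lambda>n. Phi)"
  unfolding cosimplicial_iso_def
proof (intro conjI allI impI ballI)
  show "linear_map_on fscale (T_space s sY n) fscale (B_space s s sY n) Phi" for n
    unfolding T_space_def B_space_def by (rule has_transpose_linear[OF transpose_Phi])
  show "bij_betw Phi (T_space s sY n) (B_space s s sY n)" for n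
    by (rule bij_betw_byWitness[where f' = Psi]) (auto simp: Psi_Phi Phi_Psi Phi_closed Psi_closed)
qed (auto simp: T_cosimplicial B_cosimplicial Phi_coface)

lemma Phi_elementary:
  "Phi (tensT s sY (h0 # hs) y) =
     ext2 s s fscale
       (\<lambda>a b. extL s fscale (\<lambda>gs. tensB s s sY b gs y) (ract s \<Delta> \<epsilon> hs (S a))) (\<Delta> h0)"
  unfolding Phi_def
  by (subst lin_ext_ptens[OF pointwise_multilinT[OF vs vsY] Tform_zero Tform_PhiF Phi_word_eval])
    (simp_all add: Phi_word_def)

end

theorem theorem3p5:
  fixes sH :: "'k::field \<Rightarrow> 'h::ring_1 \<Rightarrow> 'h"
    and \<Delta> :: "'h \<Rightarrow> ('k, 'h \<times> 'h) tensor" and \<epsilon> :: "'h \<Rightarrow> 'k" and S :: "'h \<Rightarrow> 'h"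
    and sY :: "'k \<Rightarrow> 'y::ab_group_add \<Rightarrow> 'y"
    and act :: "'h \<Rightarrow> 'y \<Rightarrow> 'y" and \<rho> :: "'y \<Rightarrow> ('k, 'h \<times> 'y) tensor"
  assumes "hopf_algebra sH \<Delta> \<epsilon> S" and "bij S"
    and "left_module sH sY act" and "left_comodule sH \<Delta> \<epsilon> sY \<rho>"
  shows "\<exists>\<Phi>.
    cosimplicial_iso fscale (T_space sH sY) (T_coface sH sY \<Delta> S \<rho>)
      fscale (B_space sH sH sY) (B_coface sH sH sY \<Delta> (coad sH \<Delta> S) \<rho>) \<Phi> \<and>
    (\<forall>n h0 hs y. length hs = n \<longrightarrow>
      \<Phi> n (tensT sH sY (h0 # hs) y) =
        ext2 sH sH fscale
          (\<lambda>a b. extL sH fscale (\<lambda>gs. tensB sH sH sY b gs y) (ract sH \<Delta> \<epsilon> hs (S a))) (\<Delta> h0))"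
proof -
  interpret hopf_comodule sH \<Delta> \<epsilon> S sY \<rho>
    by (intro hopf_comodule.intro hopf_comodule_axioms.intro assms)
  show ?thesis
    using Phi_cosimplicial_iso Phi_elementary by (intro exI[of _ "\<lambda>n. Phi"]) blast
qed

end
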